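(* Let $P$ be a smooth Hausdorff paracompact finite dimensional manifold and $D$ a smooth integrable generalized distribution on $P$. Let $\pi_D:P\to P/D$ be the projection onto the leaf space of $D$. Suppose that $(P,D)$ is $\overline{T}_2$-idempotent and that the projection $\pi_{T_2}:P/D\to (P/D)/\mathcal{R}_{T_2}$ is open (and hence so is $\pi_{\overline{T}_2}:P\to P/\mathcal{R}_{\overline{T}_2}$). Then the continuous first integrals of $D$ separate the $\overline{T}_2$ sets. In this situation, for any $z\in P$ there exist continuous first integrals $\{C_i\}_{i\in I}\subset C^0(P)$ of $D$ such that $$\overline{T}_2(z)=\bigcap_{i\in I}C_i^{-1}(C_i(z)).$$
   Context: A smooth generalized distribution $D$ on $P$ assigns to each point a subspace of the tangent space (of possibly varying dimension) locally spanned by values of smooth local sections; it is integrable if $P$ is partitioned into maximal connected immersed integral submanifolds, called leaves. The leaf space $P/D$ carries the quotient topology. A continuous first integral of $D$ is a continuous real function on $P$ constant on the leaves. For a topological space $X$ and $x\in X$, $T_2(x):=\{y\in X\mid U_x\cap U_y\neq\emptyset$ for any two open neighborhoods $U_x,U_y$ of $x$ and $y\}$, and $T_2(A):=\bigcup_{x\in A}T_2(x)$ for $A\subset X$. For $x\in P$, $\overline{T}_2(x):=\pi_D^{-1}(T_2(\pi_D(x)))$, and $\overline{T}_2(A):=\bigcup_{x\in A}\overline{T}_2(x)$. The pair $(P,D)$ is $\overline{T}_2$-idempotent if $\overline{T}_2(\overline{T}_2(x))=\overline{T}_2(x)$ for all $x\in P$; this is equivalent to $T_2(T_2(\rho))=T_2(\rho)$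 for all $\rho\in P/D$. Under this assumption the relations $\rho\,\mathcal{R}_{T_2}\,\sigma\iff\sigma\in T_2(\rho)$ on $P/D$ and $x\,\mathcal{R}_{\overline{T}_2}\,y\iff y\in\overline{T}_2(x)$ on $P$ are equivalence relations; $\pi_{T_2}$ and $\pi_{\overline{T}_2}=\pi_{T_2}\circ\pi_D$ are the corresponding projections onto the quotients with the quotient topology. Saying that the continuous first integrals separate the $\overline{T}_2$ sets means that whenever $\overline{T}_2(x)\neq\overline{T}_2(y)$ there is a continuous first integral $f$ of $D$ (necessarily constant on each $\overline{T}_2$ set) with $f(x)\neq f(y)$. *)

theory Defs
  imports
    "HOL-Analysis.Analysis"
    "HOL-Library.Disjoint_Sets"
    "HOL-Library.Function_Algebras"
begin

subsection \<open>Topological notions\<close>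

definition paracompact_space :: "'a topology \<Rightarrow> bool" where
  "paracompact_space X \<longleftrightarrow>
     (\<forall>\<U>. (\<forall>U\<in>\<U>. openin X U) \<and> \<Union>\<U> = topspace X \<longrightarrow>
        (\<exists>\<V>. (\<forall>V\<in>\<V>. openin X V) \<and> \<Union>\<V> = topspace X \<and>
             (\<forall>V\<in>\<V>. \<exists>U\<in>\<U>. V \<subseteq> U) \<and> locally_finite_in X \<V>))"

text \<open>The canonical projection \<open>proj r x = r `` {x}\<close> of an equivalence relation; the library hides
  its short name.\<close>

abbreviation proj :: "('a \<times> 'a) set \<Rightarrow> 'a \<Rightarrow> 'a set" where
  "proj \<equiv> Equiv_Relations.proj"

text \<open>The quotient topology on the set of classes \<open>topspace X // r\<close>.\<close>

definition quotient_topology :: "'a topology \<Rightarrow> ('a \<times> 'a) set \<Rightarrow> 'a set topology" where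
  "quotient_topology X r =
     topology (\<lambda>W. W \<subseteq> topspace X // r \<and> openin X {x \<in> topspace X. proj r x \<in> W})"

lemma openin_quotient_topology:
  "openin (quotient_topology X r) W \<longleftrightarrow>
     W \<subseteq> topspace X // r \<and> openin X {x \<in> topspace X. proj r x \<in> W}"
proof -
  have "istopology (\<lambda>W. W \<subseteq> topspace X // r \<and> openin X {x \<in> topspace X. proj r x \<in> W})"
    unfolding istopology_def
  proof (intro conjI allI impI; (elim conjE)?)
    fix S T
    assume "openin X {x \<in> topspace X. proj r x \<in> S}" "openin X {x \<in> topspace X. proj r x \<in> T}"
    then have "openin X ({x \<in> topspace X. proj r x \<in> S} \<inter> {x \<in> topspace X. proj r x \<in> T})"
      by (rule openin_Int)
    moreover have "{x \<in> topspace X. proj r x \<in> S} \<inter> {x \<in> topspace X. proj r x \<in> T}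
        = {x \<in> topspace X. proj r x \<in> S \<inter> T}"
      by auto
    ultimately show "openin X {x \<in> topspace X. proj r x \<in> S \<inter> T}"
      by simp
  next
    fix \<K>
    assume K: "\<forall>K\<in>\<K>. K \<subseteq> topspace X // r \<and> openin X {x \<in> topspace X. proj r x \<in> K}"
    have "{x \<in> topspace X. proj r x \<in> \<Union>\<K>} = (\<Union>K\<in>\<K>. {x \<in> topspace X. proj r x \<in> K})"
      by auto
    then show "openin X {x \<in> topspace X. proj r x \<in> \<Union>\<K>}"
      using K by auto
  qed auto
  then show ?thesis
    by (simp add: quotient_topology_def)
qed

lemma topspace_quotient_topology: "topspace (quotient_topology X r) = topspace X // r"
proof -
  have "{x \<in> topspace X. proj r x \<in> topspace X // r} = topspace X"
    by (auto simp: Equiv_Relations.proj_def intro: quotientI)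
  then have "openin (quotient_topology X r) (topspace X // r)"
    by (simp add: openin_quotient_topology)
  then show ?thesis
    by (meson openin_quotient_topology openin_subset openin_topspace subset_antisym)
qed

lemma quotient_map_proj: "quotient_map X (quotient_topology X r) (proj r)"
  by (auto simp: quotient_map_def topspace_quotient_topology openin_quotient_topology
      Equiv_Relations.proj_def quotient_def)

definition T2 :: "'a topology \<Rightarrow> 'a \<Rightarrow> 'a set" where
  "T2 X x = {y \<in> topspace X.
     \<forall>U V. openin X U \<and> x \<in> U \<and> openin X V \<and> y \<in> V \<longrightarrow> U \<inter> V \<noteq> {}}"

definition T2_rel :: "'a topology \<Rightarrow> ('a \<times> 'a) set" where
  "T2_rel X = {(x, y). x \<in> topspace X \<and> y \<in> T2 X x}"

subsection \<open>Smooth manifolds\<close>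

text \<open>
  Manifolds are modelled on a linear subspace \<open>V\<close> of a Euclidean space, so that the dimension
  \<open>dim V\<close> may be any natural number (0 included) and submanifolds of varying dimension can be
  treated over the same type. In \<open>Ck_on k V S f\<close> and \<open>smooth_on V S f\<close> the set \<open>S\<close> is meant to be
  relatively open in \<open>V\<close>. The derivative within such an \<open>S\<close> is uniquely determined on \<open>V\<close> (but
  not off \<open>V\<close>), hence only directions \<open>v \<in> V\<close> are used.
\<close>

primrec Ck_on :: "nat \<Rightarrow> 'e::euclidean_space set \<Rightarrow> 'e set \<Rightarrow> ('e \<Rightarrow> 'e) \<Rightarrow> bool" where
  "Ck_on 0 V S f \<longleftrightarrow> continuous_on S f"
| "Ck_on (Suc k) V S f \<longleftrightarrow>
     (\<forall>u\<in>S. f differentiable (at u within S)) \<and>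
     (\<forall>v\<in>V. Ck_on k V S (\<lambda>u. frechet_derivative f (at u within S) v))"

definition smooth_on :: "'e::euclidean_space set \<Rightarrow> 'e set \<Rightarrow> ('e \<Rightarrow> 'e) \<Rightarrow> bool" where
  "smooth_on V S f \<longleftrightarrow> (\<forall>k. Ck_on k V S f)"

text \<open>A chart is a pair of its domain and its coordinate map; the values of the latter outside of
  the domain are irrelevant.\<close>

type_synonym ('a, 'e) chart = "'a set \<times> ('a \<Rightarrow> 'e)"

record ('a, 'e) manifold =
  mtop :: "'a topology"
  model :: "'e set"
  atlas :: "('a, 'e) chart set"

abbreviation points :: "('a, 'e, 'm) manifold_scheme \<Rightarrow> 'a set" where
  "points M \<equiv> topspace (mtop M)"

definition charts_at :: "('a, 'e) manifold \<Rightarrow> 'a \<Rightarrow> ('a, 'e) chart set" where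
  "charts_at M x = {c \<in> atlas M. x \<in> fst c}"

definition is_chart :: "'a topology \<Rightarrow> 'e::euclidean_space set \<Rightarrow> ('a, 'e) chart \<Rightarrow> bool" where
  "is_chart X V c \<longleftrightarrow>
     openin X (fst c) \<and> openin (top_of_set V) (snd c ` fst c) \<and>
     homeomorphic_map (subtopology X (fst c)) (top_of_set (snd c ` fst c)) (snd c)"

text \<open>The map \<open>f\<close> read in the charts \<open>c\<close> (of the source) and \<open>d\<close> (of the target), its domain, and
  its derivative at the point with coordinates \<open>snd c x\<close>.\<close>

definition coord_dom :: "('a \<Rightarrow> 'b) \<Rightarrow> ('a, 'e) chart \<Rightarrow> ('b, 'e) chart \<Rightarrow> 'e set" where
  "coord_dom f c d = snd c ` {x \<in> fst c. f x \<in> fst d}"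

definition coord_rep :: "('a \<Rightarrow> 'b) \<Rightarrow> ('a, 'e) chart \<Rightarrow> ('b, 'e) chart \<Rightarrow> 'e \<Rightarrow> 'e" where
  "coord_rep f c d = snd d \<circ> f \<circ> inv_into (fst c) (snd c)"

definition coord_deriv ::
  "('a \<Rightarrow> 'b) \<Rightarrow> ('a, 'e::euclidean_space) chart \<Rightarrow> ('b, 'e) chart \<Rightarrow> 'a \<Rightarrow> 'e \<Rightarrow> 'e" where
  "coord_deriv f c d x =
     frechet_derivative (coord_rep f c d) (at (snd c x) within coord_dom f c d)"

text \<open>Neither the Hausdorff property nor paracompactness is part of this definition.\<close>

definition smooth_manifold :: "('a, 'e::euclidean_space) manifold \<Rightarrow> bool" where
  "smooth_manifold M \<longleftrightarrow>
     subspace (model M) \<and>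
     (\<forall>c\<in>atlas M. is_chart (mtop M) (model M) c) \<and>
     (\<Union>c\<in>atlas M. fst c) = points M \<and>
     (\<forall>c\<in>atlas M. \<forall>d\<in>atlas M. smooth_on (model M) (coord_dom id c d) (coord_rep id c d))"

subsection \<open>Tangent spaces, smooth maps and immersions\<close>

instantiation "fun" :: (type, scaleR) scaleR
begin
definition "scaleR a f = (\<lambda>x. a *\<^sub>R f x)"
instance ..
end

instance "fun" :: (type, real_vector) real_vector
  by standard (auto simp: scaleR_fun_def plus_fun_def algebra_simps)

text \<open>
  A tangent vector at \<open>x\<close> is a family of coordinate vectors, one for each chart of the atlas around
  \<open>x\<close>, any two of which correspond to each other under the derivative of the change of
  coordinates. The family is 0 at all other arguments, which makes the tangent space a linear
  subspace of the function space.
\<close>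

type_synonym ('a, 'e) tangent_vector = "('a, 'e) chart \<Rightarrow> 'e"

definition tangent_space ::
  "('a, 'e::euclidean_space) manifold \<Rightarrow> 'a \<Rightarrow> ('a, 'e) tangent_vector set" where
  "tangent_space M x =
     {\<xi>. (\<forall>c\<in>charts_at M x. \<xi> c \<in> model M) \<and>
         (\<forall>c\<in>charts_at M x. \<forall>d\<in>charts_at M x. \<xi> d = coord_deriv id c d x (\<xi> c)) \<and>
         (\<forall>c. c \<notin> charts_at M x \<longrightarrow> \<xi> c = 0)}"

definition smooth_map ::
  "('a, 'e::euclidean_space) manifold \<Rightarrow> ('b, 'e) manifold \<Rightarrow> ('a \<Rightarrow> 'b) \<Rightarrow> bool" where
  "smooth_map M N f \<longleftrightarrow>
     continuous_map (mtop M) (mtop N) f \<and>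
     (\<forall>c\<in>atlas M. \<forall>d\<in>atlas N. smooth_on (model M) (coord_dom f c d) (coord_rep f c d))"

text \<open>The result does not depend on the chart around \<open>x\<close> that is picked.\<close>

definition differential ::
  "('a, 'e::euclidean_space) manifold \<Rightarrow> ('b, 'e) manifold \<Rightarrow> ('a \<Rightarrow> 'b) \<Rightarrow> 'a \<Rightarrow>
     ('a, 'e) tangent_vector \<Rightarrow> ('b, 'e) tangent_vector" where
  "differential M N f x \<xi> =
     (\<lambda>d. if d \<in> charts_at N (f x)
          then (let c = (SOME c. c \<in> charts_at M x) in coord_deriv f c d x (\<xi> c))
          else 0)"

definition immersion ::
  "('a, 'e::euclidean_space) manifold \<Rightarrow> ('b, 'e) manifold \<Rightarrow> ('a \<Rightarrow> 'b) \<Rightarrow> bool" where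
  "immersion M N f \<longleftrightarrow>
     smooth_map M N f \<and>
     (\<forall>x\<in>points M. inj_on (differential M N f x) (tangent_space M x))"

subsection \<open>Generalized distributions and their leaves\<close>

type_synonym ('a, 'e) distribution = "'a \<Rightarrow> ('a, 'e) tangent_vector set"

definition smooth_local_section ::
  "('a, 'e::euclidean_space) manifold \<Rightarrow> ('a, 'e) distribution \<Rightarrow>
     'a set \<Rightarrow> ('a \<Rightarrow> ('a, 'e) tangent_vector) \<Rightarrow> bool" where
  "smooth_local_section P D W X \<longleftrightarrow>
     openin (mtop P) W \<and>
     (\<forall>y\<in>W. X y \<in> tangent_space P y \<and> X y \<in> D y) \<and>
     (\<forall>c\<in>atlas P. smooth_on (model P) (snd c ` (fst c \<inter> W))
                    (\<lambda>u. X (inv_into (fst c) (snd c) u) c))"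

definition smooth_distribution ::
  "('a, 'e::euclidean_space) manifold \<Rightarrow> ('a, 'e) distribution \<Rightarrow> bool" where
  "smooth_distribution P D \<longleftrightarrow>
     (\<forall>x\<in>points P.
        subspace (D x) \<and> D x \<subseteq> tangent_space P x \<and>
        D x = span {X x | X W. smooth_local_section P D W X \<and> x \<in> W})"

text \<open>
  An immersed submanifold of \<open>P\<close> is a subset with a manifold structure of its own, whose topology
  may be finer than the subspace topology, such that the inclusion is an immersion. It
  is an integral manifold of \<open>D\<close> if its tangent space is all of \<open>D\<close> at each of its points.
  The Hausdorff property and paracompactness are inherited from \<open>P\<close> (for connected
  submanifolds) and need not be required.
\<close>

definition immersed_submanifold ::
  "('a, 'e::euclidean_space) manifold \<Rightarrow> ('a, 'e) manifold \<Rightarrow> bool" where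
  "immersed_submanifold P N \<longleftrightarrow> smooth_manifold N \<and> points N \<subseteq> points P \<and> immersion N P id"

definition connected_integral_manifold ::
  "('a, 'e::euclidean_space) manifold \<Rightarrow> ('a, 'e) distribution \<Rightarrow> ('a, 'e) manifold \<Rightarrow> bool" where
  "connected_integral_manifold P D N \<longleftrightarrow>
     immersed_submanifold P N \<and> points N \<noteq> {} \<and> connected_space (mtop N) \<and>
     (\<forall>x\<in>points N. differential N P id x ` tangent_space N x = D x)"

definition leaves ::
  "('a, 'e::euclidean_space) manifold \<Rightarrow> ('a, 'e) distribution \<Rightarrow> 'a set set" where
  "leaves P D =
     {points N | N. connected_integral_manifold P D N \<and>
        (\<forall>N'. connected_integral_manifold P D N' \<and> points N \<subseteq> points N' \<longrightarrow> points N' = points N)}"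

definition integrable_distribution ::
  "('a, 'e::euclidean_space) manifold \<Rightarrow> ('a, 'e) distribution \<Rightarrow> bool" where
  "integrable_distribution P D \<longleftrightarrow> partition_on (points P) (leaves P D)"

subsection \<open>The leaf space and first integrals\<close>

definition leaf_rel ::
  "('a, 'e::euclidean_space) manifold \<Rightarrow> ('a, 'e) distribution \<Rightarrow> ('a \<times> 'a) set" where
  "leaf_rel P D = {(x, y). \<exists>L\<in>leaves P D. x \<in> L \<and> y \<in> L}"

definition leaf_space ::
  "('a, 'e::euclidean_space) manifold \<Rightarrow> ('a, 'e) distribution \<Rightarrow> 'a set topology" where
  "leaf_space P D = quotient_topology (mtop P) (leaf_rel P D)"

definition leaf_proj ::
  "('a, 'e::euclidean_space) manifold \<Rightarrow> ('a, 'e) distribution \<Rightarrow> 'a \<Rightarrow> 'a set" where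
  "leaf_proj P D = proj (leaf_rel P D)"

definition T2bar ::
  "('a, 'e::euclidean_space) manifold \<Rightarrow> ('a, 'e) distribution \<Rightarrow> 'a \<Rightarrow> 'a set" where
  "T2bar P D x = {y \<in> points P. leaf_proj P D y \<in> T2 (leaf_space P D) (leaf_proj P D x)}"

definition T2bar_idempotent ::
  "('a, 'e::euclidean_space) manifold \<Rightarrow> ('a, 'e) distribution \<Rightarrow> bool" where
  "T2bar_idempotent P D \<longleftrightarrow> (\<forall>x\<in>points P. (\<Union>y\<in>T2bar P D x. T2bar P D y) = T2bar P D x)"

definition T2bar_rel ::
  "('a, 'e::euclidean_space) manifold \<Rightarrow> ('a, 'e) distribution \<Rightarrow> ('a \<times> 'a) set" where
  "T2bar_rel P D = {(x, y). x \<in> points P \<and> y \<in> T2bar P D x}"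

definition continuous_first_integral ::
  "('a, 'e::euclidean_space) manifold \<Rightarrow> ('a, 'e) distribution \<Rightarrow> ('a \<Rightarrow> real) \<Rightarrow> bool" where
  "continuous_first_integral P D f \<longleftrightarrow>
     continuous_map (mtop P) euclideanreal f \<and>
     (\<forall>L\<in>leaves P D. \<forall>x\<in>L. \<forall>y\<in>L. f x = f y)"

end

theory Submission
  imports Defs
begin

text \<open>
  The heart of the matter is that the projection onto the leaf space is open, that is, that the
  saturation of an open set is open. Near a point of a leaf, the segment to a nearby point of the
  leaf (in a chart of the leaf) is an integral curve of a time-dependent combination of local
  sections of \<open>D\<close>. This combination is a Lipschitz vector field on an open subset of \<open>P\<close>, so its
  integral curves from neighbouring points exist by Picard's theorem and end nearby, and by
  uniqueness each of them stays in its own leaf. Hence the points of a leaf that are interior to a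
  saturated set form an open and closed subset of that leaf.

  Idempotence makes the quotient of the leaf space by \<open>T2_rel\<close> a Hausdorff space: its projection is
  open and the relation \<open>T2_rel\<close> is closed. As an open continuous image of \<open>P\<close> it is
  locally compact, thus completely regular. The pullbacks of its continuous real functions
  are the required first integrals.
\<close>

subsection \<open>Lipschitz differential equations in a subspace\<close>

text \<open>A combination of local sections with constant coefficients does not follow the segment,
  because the chosen sections agree with the coordinate fields of the leaf only at the centre; the
  coefficients must vary with time and are found by solving a linear system close to the identity. A
  second obstacle is that a leaf has a topology finer than that of \<open>P\<close>: a curve in
  \<open>P\<close> tangent to \<open>D\<close> is not known in advance to be continuous into a leaf,
  so it is compared with a curve built inside the leaf. Finally, a derivative within a relatively
  open subset of \<open>V\<close> is determined only on \<open>V\<close>, so estimates are made on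
  vectors of \<open>V\<close> or after orthogonal projection. The recurring condition that interval
  length times Lipschitz constant is at most 1/2 makes the Picard operator a contraction and
  produces the factor 2 when two solutions are compared.\<close>

lemma onorm_scaleR_vector_le:
  fixes y :: "'b::real_normed_vector"
  assumes "norm y \<le> B"
  shows "onorm (\<lambda>h::real. h *\<^sub>R y) \<le> B"
  by (rule onorm_le) (use assms in \<open>simp add: mult.commute[of B] mult_left_mono\<close>)

text \<open>In place of Gronwall's inequality, the maximum of \<open>norm (d s)\<close> is used: the
  mean value estimate from \<open>s0\<close> to a maximum point \<open>m\<close> is at most half of
  \<open>norm (d m)\<close> and is absorbed on the left. Equal values at \<open>s0\<close> give
  uniqueness, nearby values give continuous dependence. The time \<open>s0\<close> may lie anywhere
  in the interval, as the lifting of curves in both time directions requires.\<close>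

lemma lipschitz_ode_curves_close:
  fixes c e :: "real \<Rightarrow> 'e::euclidean_space"
  assumes c: "\<And>s. s \<in> {a..b} \<Longrightarrow> c s \<in> S \<and> (c has_vector_derivative Z s (c s)) (at s within {a..b})"
    and e: "\<And>s. s \<in> {a..b} \<Longrightarrow> e s \<in> S \<and> (e has_vector_derivative Z s (e s)) (at s within {a..b})"
    and Z: "\<And>s. s \<in> {a..b} \<Longrightarrow> K-lipschitz_on S (Z s)"
    and K: "(b - a) * K \<le> 1/2" and s0: "s0 \<in> {a..b}" and s: "s \<in> {a..b}"
  shows "norm (c s - e s) \<le> 2 * norm (c s0 - e s0)"
proof -
  define d where "d = (\<lambda>s. c s - e s)"
  have der: "(d has_derivative (\<lambda>h. h *\<^sub>R (Z s (c s) - Z s (e s)))) (at s within {a..b})" if "s \<in> {a..b}" for s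
    using has_vector_derivative_diff[of c "Z s (c s)" "at s within {a..b}" e "Z s (e s)"] c[OF that] e[OF that]
    by (simp add: d_def has_vector_derivative_def)
  have "continuous_on {a..b} (\<lambda>s. norm (d s))"
    by (intro continuous_on_norm has_derivative_continuous_on[OF der])
  then obtain m where m: "m \<in> {a..b}" and max: "\<And>s. s \<in> {a..b} \<Longrightarrow> norm (d s) \<le> norm (d m)"
    using continuous_attains_sup[of "{a..b}" "\<lambda>s. norm (d s)"] s by auto
  have K0: "0 \<le> K" using Z[OF s] by (rule lipschitz_on_nonneg)
  have "norm (d m - d s0) \<le> (K * norm (d m)) * norm (m - s0)"
  proof (rule differentiable_bound[OF _ der _ m s0])
    fix r assume r: "r \<in> {a..b}"
    have "norm (Z r (c r) - Z r (e r)) \<le> K * norm (d r)"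
      using lipschitz_onD[OF Z[OF r], of "c r" "e r"] c[OF r] e[OF r] by (simp add: d_def dist_norm)
    also have "\<dots> \<le> K * norm (d m)" using max[OF r] K0 by (simp add: mult_left_mono)
    finally have "norm (Z r (c r) - Z r (e r)) \<le> K * norm (d m)" .
    then show "onorm (\<lambda>h. h *\<^sub>R (Z r (c r) - Z r (e r))) \<le> K * norm (d m)"
      by (rule onorm_scaleR_vector_le)
  qed auto
  also have "\<dots> \<le> (K * norm (d m)) * (b - a)"
    using m s0 K0 by (intro mult_left_mono) (auto simp: abs_le_iff)
  also have "\<dots> = ((b - a) * K) * norm (d m)" by simp
  also have "\<dots> \<le> 1/2 * norm (d m)" using K by (intro mult_right_mono) auto
  finally have "norm (d m) \<le> 2 * norm (d s0)"
    using norm_triangle_sub[of "d m" "d s0"] by simp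
  with max[OF s] show ?thesis by (simp add: d_def)
qed

text \<open>The sum is the orthogonal projection onto \<open>V\<close>. It serves to expand vectors
  of \<open>V\<close> and, as a bounded linear map on the whole space that fixes \<open>V\<close>,
  to force integrals and derivatives into a subspace.\<close>

lemma subspace_orthonormal_basis:
  fixes V :: "'e::euclidean_space set"
  assumes "subspace V"
  obtains B where "finite B" "B \<subseteq> V" "\<And>b. b \<in> B \<Longrightarrow> norm b = 1"
    "\<And>x. x \<in> V \<Longrightarrow> (\<Sum>b\<in>B. (x \<bullet> b) *\<^sub>R b) = x"
proof -
  obtain B where B: "B \<subseteq> V" "pairwise orthogonal B" "\<And>x. x \<in> B \<Longrightarrow> norm x = 1"
    "independent B" "span B = V"
    using orthonormal_basis_subspace[OF assms] by metis
  have fin: "finite B" by (simp add: B independent_imp_finite)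
  show ?thesis
    by (rule that[OF fin B(1,3)]) (use orthonormal_basis_expand[OF B(2,3) _ fin] B(5) in auto)
qed

text \<open>The orthogonal projection onto \<open>V\<close> commutes with the integral and fixes the
  integrand on \<open>A\<close>.\<close>

lemma integral_in_subspace:
  fixes h :: "real \<Rightarrow> 'e::euclidean_space"
  assumes V: "subspace V" and h: "h integrable_on A" "\<And>r. r \<in> A \<Longrightarrow> h r \<in> V"
  shows "integral A h \<in> V"
proof -
  obtain B where B: "finite B" "B \<subseteq> V" "\<And>x. x \<in> V \<Longrightarrow> (\<Sum>b\<in>B. (x \<bullet> b) *\<^sub>R b) = x"
    using subspace_orthonormal_basis[OF V] by metis
  define p where "p = (\<lambda>x::'e. \<Sum>b\<in>B. (x \<bullet> b) *\<^sub>R b)"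
  have p: "p x = x" if "x \<in> V" for x using B(3)[OF that] by (simp add: p_def)
  have "bounded_linear p"
    unfolding p_def by (intro bounded_linear_sum bounded_linear_intros)
  then have "p (integral A h) = integral A (p \<circ> h)"
    using integral_linear h(1) by metis
  also have "\<dots> = integral A h"
    by (rule integral_cong) (use h(2) p in auto)
  moreover have "p x \<in> V" for x
    unfolding p_def using B(2) by (intro subspace_sum[OF V] subspace_scale[OF V]) auto
  ultimately show ?thesis by metis
qed

text \<open>Banach's fixed point theorem for the integral operator on continuous curves in
  \<open>cball z R \<inter> V\<close>. The bound \<open>M\<close> keeps the curves in the ball,
  \<open>K\<close> makes the operator a contraction with factor 1/2, and the values of
  \<open>Z\<close> in \<open>V\<close> keep the curves in the subspace.\<close>

lemma picard:
  fixes V :: "'e::euclidean_space set"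
  assumes V: "subspace V" and s0: "s0 \<in> {a..b}"
    and mem: "\<And>s w. s \<in> {a..b} \<Longrightarrow> w \<in> cball z R \<inter> V \<Longrightarrow> Z s w \<in> V \<and> norm (Z s w) \<le> M"
    and lip: "\<And>s. s \<in> {a..b} \<Longrightarrow> K-lipschitz_on (cball z R \<inter> V) (Z s)"
    and cont: "continuous_on ({a..b} \<times> (cball z R \<inter> V)) (\<lambda>(s, w). Z s w)"
    and w0: "w0 \<in> V" "norm (w0 - z) + (b - a) * M \<le> R" and K: "(b - a) * K \<le> 1/2"
    and M: "0 \<le> M"
  shows "\<exists>c. c s0 = w0 \<and> (\<forall>s\<in>{a..b}. c s \<in> cball z R \<inter> V \<and>
           (c has_vector_derivative Z s (c s)) (at s within {a..b}))"
proof -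
  have ab: "a \<le> b" using s0 by simp
  define Q where "Q = cball z R \<inter> V"
  have Qclosed: "closed Q" unfolding Q_def by (intro closed_Int closed_cball closed_subspace V)
  \<comment> \<open>The difference of two integrals from \<open>a\<close> is the integral from
    \<open>s0\<close> to \<open>s\<close>, with the right sign also when \<open>s\<close> precedes
    \<open>s0\<close>.\<close>
  define I where "I = (\<lambda>(c::real \<Rightarrow> 'e) s. w0 + (integral {a..s} (\<lambda>r. Z r (c r)) - integral {a..s0} (\<lambda>r. Z r (c r))))"
  have K0: "0 \<le> K" using lip[OF s0] by (rule lipschitz_on_nonneg)
  have contZ: "continuous_on {a..b} (\<lambda>r. Z r (c r))" if "continuous_on {a..b} c" "\<And>r. r \<in> {a..b} \<Longrightarrow> c r \<in> Q" for c
  proof -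
    have "continuous_on {a..b} ((\<lambda>(s, w). Z s w) \<circ> (\<lambda>r. (r, c r)))"
      using that by (intro continuous_on_compose continuous_on_subset[OF cont] continuous_intros) (auto simp: Q_def)
    then show ?thesis by (simp add: o_def)
  qed
  have der: "(I c has_vector_derivative Z s (c s)) (at s within {a..b})"
    if "continuous_on {a..b} c" "\<And>r. r \<in> {a..b} \<Longrightarrow> c r \<in> Q" "s \<in> {a..b}" for c s
  proof -
    have "((\<lambda>s. w0 + (integral {a..s} (\<lambda>r. Z r (c r)) - integral {a..s0} (\<lambda>r. Z r (c r)))) has_vector_derivative
        0 + (Z s (c s) - 0)) (at s within {a..b})"
      using integral_has_vector_derivative[OF contZ[OF that(1,2)] that(3)]
      by (intro derivative_intros) auto
    then show ?thesis by (simp add: I_def)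
  qed
  have I0: "I c s0 = w0" for c by (simp add: I_def)
  have IQ: "I c s \<in> Q" if c: "continuous_on {a..b} c" "\<And>r. r \<in> {a..b} \<Longrightarrow> c r \<in> Q" and s: "s \<in> {a..b}" for c s
  proof -
    have "norm (I c s - I c s0) \<le> M * norm (s - s0)"
    proof (rule differentiable_bound[OF _ _ _ s s0])
      fix r assume r: "r \<in> {a..b}"
      show "(I c has_derivative (\<lambda>h. h *\<^sub>R Z r (c r))) (at r within {a..b})"
        using der[OF c r] by (simp add: has_vector_derivative_def)
      have "norm (Z r (c r)) \<le> M" using mem[OF r] c(2)[OF r] by (simp add: Q_def)
      then show "onorm (\<lambda>h. h *\<^sub>R Z r (c r)) \<le> M"
        by (rule onorm_scaleR_vector_le)
    qed simp
    also have "\<dots> \<le> M * (b - a)" using s s0 M by (intro mult_left_mono) (auto simp: abs_le_iff)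
    finally have "norm (I c s - w0) \<le> (b - a) * M" by (simp add: I0 mult.commute)
    then have "norm (I c s - z) \<le> R"
      using w0(2) norm_triangle_ineq[of "I c s - w0" "w0 - z"] by simp
    moreover have "integral {a..r} (\<lambda>r. Z r (c r)) \<in> V" if "r \<in> {a..b}" for r
    proof (rule integral_in_subspace[OF V])
      show "(\<lambda>r. Z r (c r)) integrable_on {a..r}"
        using that by (intro integrable_continuous_real continuous_on_subset[OF contZ[OF c]]) auto
    qed (use that mem c in \<open>auto simp: Q_def\<close>)
    then have "I c s \<in> V" unfolding I_def using V w0(1) s s0
      by (intro subspace_add subspace_diff) auto
    ultimately show ?thesis by (simp add: Q_def dist_norm norm_minus_commute)
  qed
  \<comment> \<open>Bounded continuous functions live on the whole real line; a curve on
    \<open>{a..b}\<close> is represented by its constant extension beyond the endpoints.\<close>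
  define \<Phi> where "\<Phi> = (\<lambda>c::real \<Rightarrow>\<^sub>C 'e. Bcontfun (\<lambda>s. I c (clamp a b s)))"
  define \<Q> where "\<Q> = (PiC UNIV (\<lambda>_. Q) :: (real \<Rightarrow>\<^sub>C 'e) set)"
  have clamp: "clamp a b s \<in> {a..b}" for s
    using clamp_in_interval[of a b s] ab by simp
  have clampid: "clamp a b s = s" if "s \<in> {a..b}" for s
    using that by (intro clamp_cancel_cbox) auto
  have inQ: "c r \<in> Q" if "c \<in> \<Q>" for c r
    using that by (auto simp: \<Q>_def mem_PiC_iff)
  have \<Phi>: "apply_bcontfun (\<Phi> c) s = I c (clamp a b s)" if "c \<in> \<Q>" for c s
  proof -
    have *: "continuous_on {a..b} (I c)"
      using der[of "apply_bcontfun c"] inQ[OF that]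
      by (intro continuous_on_vector_derivative) auto
    have "(\<lambda>s. I c (clamp a b s)) \<in> bcontfun"
      unfolding bcontfun_def
    proof (intro CollectI conjI)
      show "continuous_on UNIV (\<lambda>s. I c (clamp a b s))"
        by (rule clamp_continuous_on) (use * in simp)
      show "bounded (range (\<lambda>s. I c (clamp a b s)))"
        by (rule clamp_bounded) (use compact_imp_bounded[OF compact_continuous_image[OF *]] in simp)
    qed
    then show ?thesis by (simp add: \<Phi>_def Bcontfun_inverse)
  qed
  have w0Q: "w0 \<in> Q"
  proof -
    have "0 \<le> (b - a) * M" using ab M by simp
    then show ?thesis using w0 by (auto simp: Q_def dist_norm norm_minus_commute)
  qed
  have "\<exists>!c. c \<in> \<Q> \<and> \<Phi> c = c"
  proof (rule Banach_fix)
    show "complete \<Q>" unfolding \<Q>_def complete_eq_closed by (intro closed_PiC Qclosed)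
    show "\<Q> \<noteq> {}" 
    proof -
      have "const_bcontfun w0 \<in> \<Q>" using w0Q by (simp add: \<Q>_def mem_PiC_iff const_bcontfun.rep_eq)
      then show ?thesis by blast
    qed
    show "\<Phi> ` \<Q> \<subseteq> \<Q>"
    proof (rule image_subsetI)
      fix c assume c: "c \<in> \<Q>"
      have "I c (clamp a b s) \<in> Q" for s
        by (rule IQ[OF _ _ clamp]) (use inQ[OF c] in auto)
      then have "\<Phi> c s \<in> Q" for s by (simp only: \<Phi>[OF c])
      then show "\<Phi> c \<in> \<Q>" by (simp add: \<Q>_def mem_PiC_iff)
    qed
    fix c e assume ce: "c \<in> \<Q>" "e \<in> \<Q>"
    show "dist (\<Phi> c) (\<Phi> e) \<le> 1/2 * dist c e"
    proof (rule dist_bound)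
      fix t
      define s where "s = clamp a b t"
      have s: "s \<in> {a..b}" using clamp by (simp add: s_def)
      let ?d = "\<lambda>s. I c s - I e s"
      have "norm (?d s - ?d s0) \<le> (K * dist c e) * norm (s - s0)"
      proof (rule differentiable_bound[OF _ _ _ s s0])
        fix r assume r: "r \<in> {a..b}"
        have "(?d has_vector_derivative (Z r (c r) - Z r (e r))) (at r within {a..b})"
          using der[of "apply_bcontfun c"] der[of "apply_bcontfun e"] inQ ce r
          by (intro has_vector_derivative_diff) auto
        then show "(?d has_derivative (\<lambda>h. h *\<^sub>R (Z r (c r) - Z r (e r)))) (at r within {a..b})"
          by (simp add: has_vector_derivative_def)
        have "norm (Z r (c r) - Z r (e r)) \<le> K * dist (c r) (e r)"
          using lipschitz_onD[OF lip[OF r], of "c r" "e r"] inQ ce by (auto simp: dist_norm Q_def)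
        also have "\<dots> \<le> K * dist c e" using K0 by (intro mult_left_mono dist_bounded)
        finally have "norm (Z r (c r) - Z r (e r)) \<le> K * dist c e" .
        then show "onorm (\<lambda>h. h *\<^sub>R (Z r (c r) - Z r (e r))) \<le> K * dist c e"
          by (rule onorm_scaleR_vector_le)
      qed simp
      also have "\<dots> \<le> (K * dist c e) * (b - a)" using s s0 K0 by (intro mult_left_mono) (auto simp: abs_le_iff)
      also have "\<dots> = ((b - a) * K) * dist c e" by simp
      also have "\<dots> \<le> 1/2 * dist c e" using K by (intro mult_right_mono) auto
      finally show "dist (\<Phi> c t) (\<Phi> e t) \<le> 1/2 * dist c e"
        using ce by (simp add: \<Phi> I0 dist_norm s_def)
    qed
  qed auto
  then obtain c where c: "c \<in> \<Q>" "\<Phi> c = c" by auto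
  have eq: "c s = I c s" if "s \<in> {a..b}" for s
    using \<Phi>[OF c(1), of s] c(2) clampid[OF that] by simp
  have "(apply_bcontfun c has_vector_derivative Z s (c s)) (at s within {a..b})" if s: "s \<in> {a..b}" for s
  proof (rule has_vector_derivative_transform[OF s])
    show "(I c has_vector_derivative Z s (c s)) (at s within {a..b})"
      by (rule der[OF _ _ s]) (use inQ[OF c(1)] in auto)
  qed (rule eq)
  moreover have "c s0 = w0" using eq[OF s0] I0 by metis
  moreover have "c s \<in> cball z R \<inter> V" for s using inQ[OF c(1)] by (simp only: Q_def)
  ultimately show ?thesis by blast
qed

subsection \<open>Local estimates for smooth maps\<close>

text \<open>Smallness conditions on a radius are stated as eventual properties at
  \<open>at_right 0\<close>, so that finitely many of them can be combined before one radius is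
  chosen.\<close>

lemma eventually_cball_Int_subset:
  fixes u :: "'e::euclidean_space"
  assumes "openin (top_of_set V) S" "u \<in> S"
  shows "\<forall>\<^sub>F R in at_right 0. cball u R \<inter> V \<subseteq> S"
proof -
  obtain e where e: "e > 0" "cball u e \<inter> V \<subseteq> S"
    using assms unfolding openin_contains_cball by metis
  have "\<forall>\<^sub>F R in at_right 0. R < e"
    using e(1) by (rule eventually_at_right_real[THEN eventually_mono]) auto
  then show ?thesis by eventually_elim (use e(2) in auto)
qed

lemma norm_sum_inner_scaleR_le:
  fixes x :: "'e::euclidean_space" and y :: "'e \<Rightarrow> 'b::real_normed_vector"
  assumes "\<And>b. b \<in> B \<Longrightarrow> norm b = 1"
  shows "norm (\<Sum>b\<in>B. (x \<bullet> b) *\<^sub>R y b) \<le> norm x * (\<Sum>b\<in>B. norm (y b))"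
proof -
  have "norm (\<Sum>b\<in>B. (x \<bullet> b) *\<^sub>R y b) \<le> (\<Sum>b\<in>B. norm x * norm (y b))"
  proof (rule sum_norm_le)
    fix b assume "b \<in> B"
    then have "\<bar>x \<bullet> b\<bar> \<le> norm x" using Cauchy_Schwarz_ineq2[of x b] assms by simp
    then show "norm ((x \<bullet> b) *\<^sub>R y b) \<le> norm x * norm (y b)" by (simp add: mult_right_mono)
  qed
  then show ?thesis by (simp add: sum_distrib_left)
qed

text \<open>Off \<open>V\<close> the map \<open>A u\<close> is not determined by \<open>f\<close>,
  so its operator norm cannot be used. Precomposition with the orthogonal projection
  \<open>p\<close> changes nothing on \<open>Q\<close> and yields the derivative
  \<open>A u \<circ> p\<close>, which is controlled by the finitely many values
  \<open>A u b\<close>; these are bounded on the compact convex set \<open>Q\<close>.\<close>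

lemma eventually_lipschitz_C1:
  fixes V :: "'e::euclidean_space set"
  assumes V: "subspace V" and S: "openin (top_of_set V) S" and u0: "u0 \<in> S" and f: "Ck_on (Suc 0) V S f"
  shows "\<forall>\<^sub>F R in at_right 0. \<exists>K. K-lipschitz_on (cball u0 R \<inter> V) f"
proof -
  obtain B where B: "finite B" "B \<subseteq> V" "\<And>b. b \<in> B \<Longrightarrow> norm b = 1"
    "\<And>x. x \<in> V \<Longrightarrow> (\<Sum>b\<in>B. (x \<bullet> b) *\<^sub>R b) = x"
    using subspace_orthonormal_basis[OF V] by metis
  define p where "p = (\<lambda>x::'e. \<Sum>b\<in>B. (x \<bullet> b) *\<^sub>R b)"
  have blp: "bounded_linear p"
    unfolding p_def by (intro bounded_linear_sum bounded_linear_intros)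
  define A where "A = (\<lambda>u. frechet_derivative f (at u within S))"
  have SV: "S \<subseteq> V" using S openin_imp_subset by blast
  have A: "(f has_derivative A u) (at u within S)" if "u \<in> S" for u
    using f that by (simp add: A_def frechet_derivative_works)
  have contA: "continuous_on S (\<lambda>u. A u b)" if "b \<in> B" for b
    using f that B(2) by (auto simp: A_def)
  have "\<forall>\<^sub>F R in at_right 0. 0 < R \<and> cball u0 R \<inter> V \<subseteq> S"
    using eventually_cball_Int_subset[OF S u0] eventually_at_right_less by eventually_elim auto
  then show ?thesis
  proof eventually_elim
    case (elim R)
    define Q where "Q = cball u0 R \<inter> V"
    have Q: "Q \<subseteq> S" "Q \<subseteq> V" "convex Q" "compact Q"
      using elim V by (auto simp: Q_def convex_Int subspace_imp_convex compact_Int_closed closed_subspace)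
    have "continuous_on Q (\<lambda>u. \<Sum>b\<in>B. norm (A u b))"
      by (intro continuous_on_sum continuous_on_norm continuous_on_subset[OF contA Q(1)])
    then have "bounded ((\<lambda>u. \<Sum>b\<in>B. norm (A u b)) ` Q)"
      using Q(4) compact_continuous_image compact_imp_bounded by blast
    then obtain K where K: "\<forall>x\<in>(\<lambda>u. \<Sum>b\<in>B. norm (A u b)) ` Q. norm x \<le> K" "K > 0"
      unfolding bounded_pos by metis
    have K': "(\<Sum>b\<in>B. norm (A u b)) \<le> K" if "u \<in> Q" for u
      using K(1) that by (force simp: sum_nonneg)
    have "K-lipschitz_on Q f"
    proof (rule lipschitz_onI)
      fix x y assume xy: "x \<in> Q" "y \<in> Q"
      have "norm (f x - f y) \<le> K * norm (x - y)"
      proof (rule differentiable_bound[OF Q(3) _ _ xy])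
        fix u assume u: "u \<in> Q"
        have pQ: "p x = x" if "x \<in> Q" for x using B(4) Q that by (auto simp: p_def)
        have "(f has_derivative A u) (at (p u) within p ` Q)"
          using A[of u] u Q pQ by (auto intro: has_derivative_subset)
        then have "((f \<circ> p) has_derivative A u \<circ> p) (at u within Q)"
          by (rule diff_chain_within[OF bounded_linear_imp_has_derivative[OF blp]])
        then show "(f has_derivative A u \<circ> p) (at u within Q)"
          by (rule has_derivative_transform[OF u, rotated]) (simp add: pQ)
        show "onorm (A u \<circ> p) \<le> K"
        proof (rule onorm_le)
          fix x
          have lin: "linear (A u)" using A[of u] u Q has_derivative_linear by blast
          have "(A u \<circ> p) x = (\<Sum>b\<in>B. (x \<bullet> b) *\<^sub>R A u b)"
            by (simp add: p_def linear_sum[OF lin] linear_scale[OF lin])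
          also have "norm \<dots> \<le> norm x * (\<Sum>b\<in>B. norm (A u b))"
            using B(3) by (rule norm_sum_inner_scaleR_le)
          also have "\<dots> \<le> norm x * K" using K'[OF u] by (simp add: mult_left_mono)
          finally show "norm ((A u \<circ> p) x) \<le> K * norm x" by (simp add: mult.commute)
        qed
      qed
      then show "dist (f x) (f y) \<le> K * dist x y" by (simp add: dist_norm)
    qed (use K in simp)
    then show ?case by (auto simp: Q_def)
  qed
qed

text \<open>The Lipschitz bound for C1 maps is applied to each \<open>\<lambda>u. A u b\<close>, and
  linearity spreads it over \<open>V\<close>. The estimate is made vector by vector because
  \<open>A u\<close> is determined only on \<open>V\<close>.\<close>

lemma eventually_lipschitz_derivative_C2:
  fixes V :: "'e::euclidean_space set"
  assumes V: "subspace V" and S: "openin (top_of_set V) S" and u0: "u0 \<in> S"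
    and f: "Ck_on (Suc (Suc 0)) V S f"
  defines "A \<equiv> \<lambda>u. frechet_derivative f (at u within S)"
  shows "\<forall>\<^sub>F R in at_right 0. \<exists>K\<ge>0. \<forall>u\<in>cball u0 R \<inter> V. \<forall>u'\<in>cball u0 R \<inter> V. \<forall>v\<in>V.
           norm (A u v - A u' v) \<le> K * norm (u - u') * norm v"
proof -
  obtain B where B: "finite B" "B \<subseteq> V" "\<And>b. b \<in> B \<Longrightarrow> norm b = 1"
    "\<And>x. x \<in> V \<Longrightarrow> (\<Sum>b\<in>B. (x \<bullet> b) *\<^sub>R b) = x"
    using subspace_orthonormal_basis[OF V] by metis
  have "\<forall>\<^sub>F R in at_right 0. \<exists>K. K-lipschitz_on (cball u0 R \<inter> V) (\<lambda>u. A u b)" if "b \<in> B" for b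
    by (rule eventually_lipschitz_C1[OF V S u0]) (use f that B(2) in \<open>auto simp: A_def\<close>)
  then have "\<forall>\<^sub>F R in at_right 0. \<forall>b\<in>B. \<exists>K. K-lipschitz_on (cball u0 R \<inter> V) (\<lambda>u. A u b)"
    using B(1) by (simp add: eventually_ball_finite)
  with eventually_cball_Int_subset[OF S u0] show ?thesis
  proof eventually_elim
    case (elim R)
    then obtain K where K: "\<And>b. b \<in> B \<Longrightarrow> (K b)-lipschitz_on (cball u0 R \<inter> V) (\<lambda>u. A u b)" by metis
    have lin: "linear (A u)" if "u \<in> cball u0 R \<inter> V" for u
    proof -
      have "u \<in> S" using that elim(1) by blast
      then have "f differentiable (at u within S)" using f by simp
      then show ?thesis by (simp add: A_def linear_frechet_derivative)
    qed
    show ?case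
    proof (intro exI[of _ "\<Sum>b\<in>B. K b"] conjI ballI)
      show "0 \<le> (\<Sum>b\<in>B. K b)" using lipschitz_on_nonneg[OF K] by (simp add: sum_nonneg)
      fix u u' v assume u: "u \<in> cball u0 R \<inter> V" and u': "u' \<in> cball u0 R \<inter> V" and v: "v \<in> V"
      have Av: "A x v = (\<Sum>b\<in>B. (v \<bullet> b) *\<^sub>R A x b)" if "x \<in> cball u0 R \<inter> V" for x
        by (subst B(4)[OF v, symmetric]) (simp add: linear_sum[OF lin[OF that]] linear_scale[OF lin[OF that]])
      have "A u v - A u' v = (\<Sum>b\<in>B. (v \<bullet> b) *\<^sub>R (A u b - A u' b))"
        using Av[OF u] Av[OF u'] by (simp add: algebra_simps sum_subtractf)
      also have "norm \<dots> \<le> norm v * (\<Sum>b\<in>B. norm (A u b - A u' b))"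
        using B(3) by (rule norm_sum_inner_scaleR_le)
      also have "\<dots> \<le> norm v * (\<Sum>b\<in>B. K b * norm (u - u'))"
        using lipschitz_onD[OF K u u'] by (intro mult_left_mono sum_mono) (auto simp: dist_norm)
      finally show "norm (A u v - A u' v) \<le> (\<Sum>b\<in>B. K b) * norm (u - u') * norm v"
        by (simp add: sum_distrib_right mult_ac)
    qed
  qed
qed

section \<open>Linear systems close to the identity with Lipschitz data\<close>

lemma near_identity_lower_bound:
  fixes m w :: "'e::real_normed_vector"
  assumes "norm (m - w) \<le> norm w / 2"
  shows "norm w \<le> 2 * norm m"
  using assms norm_triangle_sub[of w m] by (simp add: norm_minus_commute)

text \<open>A map within half of the identity is bounded below on \<open>V\<close>, hence injective
  there, and a dimension count makes it onto \<open>V\<close>. The same lower bound yields the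
  Lipschitz dependence of the solution on \<open>u\<close>.\<close>

lemma solve_near_identity:
  fixes V :: "'e::euclidean_space set" and M :: "'e \<Rightarrow> 'e \<Rightarrow> 'e"
  assumes V: "subspace V" and lin: "\<And>u. u \<in> Q \<Longrightarrow> linear (M u)"
    and M: "\<And>u w. u \<in> Q \<Longrightarrow> w \<in> V \<Longrightarrow> M u w \<in> V \<and> norm (M u w - w) \<le> norm w / 2"
    and lipM: "\<And>u u' w. u \<in> Q \<Longrightarrow> u' \<in> Q \<Longrightarrow> w \<in> V \<Longrightarrow> norm (M u w - M u' w) \<le> K * norm (u - u') * norm w"
    and K: "0 \<le> K"
    and g: "\<And>u. u \<in> Q \<Longrightarrow> g u \<in> V \<and> norm (g u) \<le> G" and lipg: "C-lipschitz_on Q g"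
  shows "\<exists>Y. (\<forall>u\<in>Q. Y u \<in> V \<and> M u (Y u) = g u \<and> norm (Y u) \<le> 2 * G) \<and> (\<exists>C'. C'-lipschitz_on Q Y)"
proof -
  have low: "norm w \<le> 2 * norm (M u w)" if "u \<in> Q" "w \<in> V" for u w
    using M[OF that] by (intro near_identity_lower_bound) auto
  have "\<exists>y\<in>V. M u y = g u" if u: "u \<in> Q" for u
  proof -
    have "inj_on (M u) V"
      unfolding linear_inj_on_iff_eq_0[OF lin[OF u] V] using low[OF u] by force
    then have "dim (M u ` V) = dim V"
      by (intro dim_image_eq lin u) (use V span_eq_iff in \<open>metis\<close>)
    then have "M u ` V = V"
      using M[OF u] by (intro subspace_dim_equal linear_subspace_image lin u V) auto
    with g[OF u] show ?thesis by (metis imageE)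
  qed
  then obtain Y where Y: "\<And>u. u \<in> Q \<Longrightarrow> Y u \<in> V \<and> M u (Y u) = g u" by metis
  have YG: "norm (Y u) \<le> 2 * G" if "u \<in> Q" for u
    using low[OF that, of "Y u"] Y[OF that] g[OF that] by simp
  \<comment> \<open>The modulus covers an empty \<open>Q\<close>, where \<open>G\<close> may be
    negative.\<close>
  have "(2 * (C + K * (2 * \<bar>G\<bar>)))-lipschitz_on Q Y"
  proof (rule lipschitz_onI)
    show "0 \<le> 2 * (C + K * (2 * \<bar>G\<bar>))" using K lipschitz_on_nonneg[OF lipg] by simp
    fix u u' assume u: "u \<in> Q" and u': "u' \<in> Q"
    \<comment> \<open>The two equations are subtracted so that \<open>M u\<close> acts on the
      difference of the solutions, while the change of the operator acts on the single vector
      \<open>Y u'\<close>.\<close>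
    have "M u (Y u - Y u') = (g u - g u') - (M u (Y u') - M u' (Y u'))"
      using Y[OF u] Y[OF u'] by (simp add: linear_diff[OF lin[OF u]])
    then have "norm (M u (Y u - Y u')) \<le> norm (g u - g u') + norm (M u (Y u') - M u' (Y u'))"
      by (metis norm_triangle_ineq4)
    also have "\<dots> \<le> C * norm (u - u') + K * norm (u - u') * norm (Y u')"
      using lipschitz_onD[OF lipg u u'] lipM[OF u u', of "Y u'"] Y[OF u'] by (simp add: dist_norm)
    also have "\<dots> \<le> C * norm (u - u') + K * norm (u - u') * (2 * \<bar>G\<bar>)"
      using YG[OF u'] K by (intro add_left_mono mult_left_mono) auto
    finally have "2 * norm (M u (Y u - Y u')) \<le> 2 * (C * norm (u - u') + K * norm (u - u') * (2 * \<bar>G\<bar>))"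
      by (rule mult_left_mono) simp
    moreover have "norm (Y u - Y u') \<le> 2 * norm (M u (Y u - Y u'))"
      using Y[OF u] Y[OF u'] by (intro low u subspace_diff V) auto
    ultimately have "norm (Y u - Y u') \<le> 2 * (C * norm (u - u') + K * norm (u - u') * (2 * \<bar>G\<bar>))"
      by (rule order_trans[rotated])
    then show "dist (Y u) (Y u') \<le> 2 * (C + K * (2 * \<bar>G\<bar>)) * dist u u'"
      by (simp add: dist_norm algebra_simps)
  qed
  with Y YG show ?thesis by blast
qed

section \<open>Finite families of Lipschitz fields and their time-dependent combinations\<close>

lemma uniform_lipschitz_bounded:
  fixes X :: "'b \<Rightarrow> 'e::euclidean_space \<Rightarrow> 'e"
  assumes "finite B" "bounded Q" and X: "\<And>b. b \<in> B \<Longrightarrow> \<exists>C. C-lipschitz_on Q (X b)"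
  shows "\<exists>C\<ge>0. \<exists>G\<ge>0. \<forall>b\<in>B. C-lipschitz_on Q (X b) \<and> (\<forall>w\<in>Q. norm (X b w) \<le> G)"
proof -
  obtain C where C: "\<And>b. b \<in> B \<Longrightarrow> (C b)-lipschitz_on Q (X b)" using X by metis
  have C0: "0 \<le> C b" if "b \<in> B" for b using C[OF that] by (rule lipschitz_on_nonneg)
  have "\<exists>G. 0 \<le> G \<and> (\<forall>w\<in>Q. norm (X b w) \<le> G)" if "b \<in> B" for b
    using lipschitz_on_uniformly_continuous[OF C[OF that]]
      bounded_uniformly_continuous_image[of Q "X b"] assms(2)
    unfolding bounded_pos by (metis imageI less_imp_le)
  then obtain G where G: "\<And>b. b \<in> B \<Longrightarrow> 0 \<le> G b \<and> (\<forall>w\<in>Q. norm (X b w) \<le> G b)" by metis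
  \<comment> \<open>Sums as common bounds avoid a separate case for an empty
    \<open>B\<close>.\<close>
  have "C b \<le> sum C B" "G b \<le> sum G B" if "b \<in> B" for b
    using that assms(1) C0 G by (auto intro!: member_le_sum)
  then have "(sum C B)-lipschitz_on Q (X b) \<and> (\<forall>w\<in>Q. norm (X b w) \<le> sum G B)" if "b \<in> B" for b
    using lipschitz_on_le[OF C[OF that]] G[OF that] that by (meson order_trans)
  moreover have "0 \<le> sum C B" "0 \<le> sum G B" using C0 G by (simp_all add: sum_nonneg)
  ultimately show ?thesis by blast
qed

text \<open>The conclusions are the bound, the Lipschitz condition and the joint continuity that
  \<open>picard\<close> asks of a time-dependent field. Time enters only through the coefficients
  and position only through the fields, so each estimate is a product of two.\<close>

lemma combination_of_fields:
  fixes X :: "'b \<Rightarrow> 'e::euclidean_space \<Rightarrow> 'e"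
  assumes "finite B" and X: "\<And>b. b \<in> B \<Longrightarrow> C-lipschitz_on Q (X b) \<and> (\<forall>w\<in>Q. norm (X b w) \<le> G)"
    and t: "\<And>b s. b \<in> B \<Longrightarrow> s \<in> A \<Longrightarrow> \<bar>t b s\<bar> \<le> T" and ct: "\<And>b. b \<in> B \<Longrightarrow> continuous_on A (t b)"
    and CT: "0 \<le> C" "0 \<le> T" "0 \<le> G"
  shows "\<And>s w. s \<in> A \<Longrightarrow> w \<in> Q \<Longrightarrow> norm (\<Sum>b\<in>B. t b s *\<^sub>R X b w) \<le> real (card B) * (T * G)"
    and "\<And>s. s \<in> A \<Longrightarrow> (real (card B) * (T * C))-lipschitz_on Q (\<lambda>w. \<Sum>b\<in>B. t b s *\<^sub>R X b w)"
    and "continuous_on (A \<times> Q) (\<lambda>(s, w). \<Sum>b\<in>B. t b s *\<^sub>R X b w)"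
proof -
  fix s assume s: "s \<in> A"
  show "norm (\<Sum>b\<in>B. t b s *\<^sub>R X b w) \<le> real (card B) * (T * G)" if w: "w \<in> Q" for w
  proof (rule sum_norm_bound)
    fix b assume b: "b \<in> B"
    show "norm (t b s *\<^sub>R X b w) \<le> T * G"
      using t[OF b s] X[OF b] w CT by (auto intro!: mult_mono)
  qed
  show "(real (card B) * (T * C))-lipschitz_on Q (\<lambda>w. \<Sum>b\<in>B. t b s *\<^sub>R X b w)"
  proof (rule lipschitz_onI)
    fix x y assume xy: "x \<in> Q" "y \<in> Q"
    have "norm (\<Sum>b\<in>B. t b s *\<^sub>R (X b x - X b y)) \<le> real (card B) * (T * (C * norm (x - y)))"
    proof (rule sum_norm_bound)
      fix b assume b: "b \<in> B"
      have "norm (X b x - X b y) \<le> C * norm (x - y)"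
        using X[OF b] lipschitz_onD[of C Q "X b" x y] xy by (simp add: dist_norm)
      then show "norm (t b s *\<^sub>R (X b x - X b y)) \<le> T * (C * norm (x - y))"
        using t[OF b s] CT by (auto intro!: mult_mono)
    qed
    then show "dist (\<Sum>b\<in>B. t b s *\<^sub>R X b x) (\<Sum>b\<in>B. t b s *\<^sub>R X b y) \<le> real (card B) * (T * C) * dist x y"
      by (simp add: dist_norm sum_subtractf scaleR_diff_right mult_ac)
  qed (use CT in simp)
next
  show "continuous_on (A \<times> Q) (\<lambda>(s, w). \<Sum>b\<in>B. t b s *\<^sub>R X b w)"
    unfolding split_def
  proof (intro continuous_on_sum continuous_on_scaleR)
    fix b assume b: "b \<in> B"
    show "continuous_on (A \<times> Q) (\<lambda>x. t b (fst x))"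
      by (rule continuous_on_compose2[OF ct[OF b]]) (auto intro!: continuous_intros)
    show "continuous_on (A \<times> Q) (\<lambda>x. X b (snd x))"
      by (rule continuous_on_compose2[OF lipschitz_on_continuous_on[of C Q "X b"]])
        (use X[OF b] in \<open>auto intro!: continuous_intros\<close>)
  qed
qed

subsection \<open>Vector fields tangent to an immersion\<close>

lemma smooth_on_continuous_on: "smooth_on V S F \<Longrightarrow> continuous_on S F"
  unfolding smooth_on_def using Ck_on.simps(1) by blast

lemma smooth_on_has_derivative:
  assumes "smooth_on V S F" "u \<in> S"
  shows "(F has_derivative frechet_derivative F (at u within S)) (at u within S)"
proof -
  have "Ck_on (Suc 0) V S F" using assms(1) by (simp only: smooth_on_def)
  then have "F differentiable (at u within S)" using assms(2) by simp
  then show ?thesis by (simp add: frechet_derivative_works)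
qed

lemma openin_preimage_continuous:
  assumes "openin (top_of_set V) S" "continuous_on S f" "open U"
  shows "openin (top_of_set V) {u \<in> S. f u \<in> U}"
proof -
  have "openin (top_of_set S) (S \<inter> f -` U)"
    using assms(2,3) by (rule continuous_openin_preimage_gen)
  moreover have "S \<inter> f -` U = {u \<in> S. f u \<in> U}" by auto
  ultimately show ?thesis using assms(1) openin_trans by metis
qed

lemma eventually_cball_in_preimage:
  fixes u0 :: "'e::euclidean_space"
  assumes "openin (top_of_set V) S" "continuous_on S f" "open U" "u0 \<in> S" "f u0 \<in> U"
  shows "\<forall>\<^sub>F r in at_right 0. \<forall>u\<in>cball u0 r \<inter> V. u \<in> S \<and> f u \<in> U"
  using eventually_cball_Int_subset[OF openin_preimage_continuous[OF assms(1-3)], of u0] assms(4,5)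
  by (auto elim: eventually_mono)

text \<open>\<open>L\<close> inverts the derivative at \<open>u0\<close> and is then kept constant:
  as the derivative varies in a Lipschitz way, \<open>L (A u v)\<close> stays within half of
  \<open>v\<close> for \<open>u\<close> near \<open>u0\<close>. Applying this one \<open>L\<close>
  turns equations between vectors tangent to the immersion into equations in \<open>V\<close> of the
  kind that \<open>solve_near_identity\<close> treats.\<close>

lemma immersion_left_inverse:
  fixes F :: "'e::euclidean_space \<Rightarrow> 'e"
  assumes V: "subspace V" and S: "openin (top_of_set V) S" and u0: "u0 \<in> S" and F: "smooth_on V S F"
  defines "A \<equiv> \<lambda>u. frechet_derivative F (at u within S)"
  assumes inj: "inj_on (A u0) V"
  obtains L where "linear L" "\<And>x. L x \<in> V" "\<And>v. v \<in> V \<Longrightarrow> L (A u0 v) = v"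
    "\<forall>\<^sub>F r in at_right 0. \<forall>u\<in>cball u0 r \<inter> V. \<forall>v\<in>V. norm (L (A u v) - v) \<le> norm v / 2"
    "\<forall>\<^sub>F r in at_right 0. \<exists>K\<ge>0. \<forall>u\<in>cball u0 r \<inter> V. \<forall>u'\<in>cball u0 r \<inter> V. \<forall>v\<in>V.
       norm (L (A u v) - L (A u' v)) \<le> K * norm (u - u') * norm v"
proof -
  have "linear (A u0)"
    using smooth_on_has_derivative[OF F u0] has_derivative_linear unfolding A_def by blast
  then obtain L where L: "range L \<subseteq> V" "linear L" "\<And>v. v \<in> V \<Longrightarrow> L (A u0 v) = v"
    using linear_exists_left_inverse_on[OF _ V inj] by metis
  then obtain C where C: "C > 0" "\<And>x. norm (L x) \<le> C * norm x"
    using linear_bounded_pos by blast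
  have "Ck_on (Suc (Suc 0)) V S F" using F unfolding smooth_on_def by blast
  from eventually_lipschitz_derivative_C2[OF V S u0 this]
  have lip: "\<forall>\<^sub>F r in at_right 0. \<exists>K\<ge>0. \<forall>u\<in>cball u0 r \<inter> V. \<forall>u'\<in>cball u0 r \<inter> V. \<forall>v\<in>V.
       norm (L (A u v) - L (A u' v)) \<le> K * norm (u - u') * norm v"
  proof eventually_elim
    case (elim r)
    then obtain K where K: "K \<ge> 0" "\<And>u u' v. u \<in> cball u0 r \<inter> V \<Longrightarrow> u' \<in> cball u0 r \<inter> V \<Longrightarrow> v \<in> V \<Longrightarrow>
       norm (A u v - A u' v) \<le> K * norm (u - u') * norm v" unfolding A_def by blast
    have "norm (L (A u v) - L (A u' v)) \<le> (C * K) * norm (u - u') * norm v"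
      if "u \<in> cball u0 r \<inter> V" "u' \<in> cball u0 r \<inter> V" "v \<in> V" for u u' v
    proof -
      have "norm (L (A u v) - L (A u' v)) \<le> C * norm (A u v - A u' v)"
        using C(2)[of "A u v - A u' v"] by (simp add: linear_diff[OF L(2)])
      also have "\<dots> \<le> C * (K * norm (u - u') * norm v)"
        using K(2)[OF that] C(1) by (intro mult_left_mono) auto
      finally show ?thesis by (simp add: mult_ac)
    qed
    moreover have "C * K \<ge> 0" using C(1) K(1) by simp
    ultimately show ?case by blast
  qed
  have u0V: "u0 \<in> V" using S u0 openin_imp_subset by blast
  have "\<forall>\<^sub>F r in at_right 0. \<forall>u\<in>cball u0 r \<inter> V. \<forall>v\<in>V. norm (L (A u v) - v) \<le> norm v / 2"
  proof -
    obtain R where R: "R > 0" and "\<exists>K\<ge>0. \<forall>u\<in>cball u0 R \<inter> V. \<forall>u'\<in>cball u0 R \<inter> V. \<forall>v\<in>V.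
       norm (L (A u v) - L (A u' v)) \<le> K * norm (u - u') * norm v"
      using eventually_happens[OF eventually_conj[OF lip eventually_at_right_less]] by auto
    then obtain K where K: "K \<ge> 0" "\<And>u u' v. u \<in> cball u0 R \<inter> V \<Longrightarrow> u' \<in> cball u0 R \<inter> V \<Longrightarrow> v \<in> V \<Longrightarrow>
       norm (L (A u v) - L (A u' v)) \<le> K * norm (u - u') * norm v" by blast
    \<comment> \<open>Within distance \<open>q\<close> of \<open>u0\<close>, the factor
      \<open>K * norm (u - u0)\<close> is at most 1/2; \<open>K + 1\<close> in place of
      \<open>K\<close> avoids a division by zero.\<close>
    define q where "q = min R (1 / (2 * (K + 1)))"
    have q0: "0 < q" using R K by (simp add: q_def)
    have "\<forall>\<^sub>F r in at_right 0. r < q"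
      using q0 by (rule eventually_at_right_real[THEN eventually_mono]) auto
    then show ?thesis
    proof eventually_elim
      case (elim r)
      show ?case
      proof (intro ballI)
        fix u v assume u: "u \<in> cball u0 r \<inter> V" and v: "v \<in> V"
        have "r \<ge> 0" using u by (auto intro: order_trans[OF zero_le_dist])
        have ur: "norm (u - u0) \<le> q" using u elim by (auto simp: dist_norm norm_minus_commute)
        then have "u \<in> cball u0 R \<inter> V" using u by (auto simp: dist_norm norm_minus_commute q_def)
        moreover have "u0 \<in> cball u0 R \<inter> V" using R u0V by simp
        ultimately have "norm (L (A u v) - v) \<le> K * norm (u - u0) * norm v"
          using K(2)[of u u0 v] v L(3) by simp
        also have "\<dots> \<le> (1/2) * norm v"
        proof (rule mult_right_mono)
          have "K * norm (u - u0) \<le> (K + 1) * (1 / (2 * (K + 1)))"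
            using ur K(1) by (intro mult_mono) (auto simp: q_def)
          also have "\<dots> = 1/2" using K(1) by (simp add: field_simps)
          finally show "K * norm (u - u0) \<le> 1/2" .
        qed simp
        finally show "norm (L (A u v) - v) \<le> norm v / 2" by simp
      qed
    qed
  qed
  then show ?thesis using that[OF L(2) _ L(3) _ lip] L(1) by blast
qed

lemma eventually_lipschitz_pullback:
  fixes F L :: "'e::euclidean_space \<Rightarrow> 'e"
  assumes V: "subspace V" and S: "openin (top_of_set V) S" and u0: "u0 \<in> S" and F: "smooth_on V S F"
    and FW: "F ` S \<subseteq> W" and X: "C-lipschitz_on (ball z R \<inter> W) X" and z: "F u0 \<in> ball z R" and L: "linear L"
  shows "\<forall>\<^sub>F r in at_right 0. \<exists>C. C-lipschitz_on (cball u0 r \<inter> V) (\<lambda>u. L (X (F u)))"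
proof -
  have "Ck_on (Suc 0) V S F" using F unfolding smooth_on_def by blast
  from eventually_lipschitz_C1[OF V S u0 this]
    eventually_cball_in_preimage[OF S smooth_on_continuous_on[OF F] open_ball u0 z]
  show ?thesis
  proof eventually_elim
    case (elim r)
    define Q where "Q = cball u0 r \<inter> V"
    obtain K where K: "K-lipschitz_on Q F" using elim(1) by (auto simp: Q_def)
    have "F ` Q \<subseteq> ball z R \<inter> W" using elim(2) FW by (auto simp: Q_def)
    then have "C-lipschitz_on (F ` Q) X" using X lipschitz_on_subset by blast
    from lipschitz_on_compose[OF K this] have *: "(C * K)-lipschitz_on Q (X \<circ> F)" .
    obtain D where "D-lipschitz_on ((X \<circ> F) ` Q) L"
      by (rule bounded_linear.lipschitz_boundE[OF linear_conv_bounded_linear[THEN iffD1, OF L]])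
    from lipschitz_on_compose[OF * this] show ?case unfolding Q_def o_def by blast
  qed
qed

text \<open>The vector fields \<open>X b\<close> pull back along the immersion \<open>F\<close>. The solution of the pulled back
  equation is mapped by \<open>F\<close> to a solution of the original one, hence to \<open>c\<close>.\<close>

lemma integral_curve_lifts:
  fixes F :: "'e::euclidean_space \<Rightarrow> 'e" and X :: "'b \<Rightarrow> 'e \<Rightarrow> 'e"
  assumes V: "subspace V" and S: "openin (top_of_set V) S" and u0: "u0 \<in> S" and F: "smooth_on V S F"
    and FW: "F ` S \<subseteq> W"
    and inj: "inj_on (frechet_derivative F (at u0 within S)) V"
    and B: "finite B" and X: "\<And>b. b \<in> B \<Longrightarrow> \<exists>C. C-lipschitz_on (ball z R \<inter> W) (X b)"
    and tan: "\<And>b u. b \<in> B \<Longrightarrow> u \<in> S \<Longrightarrow> F u \<in> ball z R \<Longrightarrow>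
            X b (F u) \<in> frechet_derivative F (at u within S) ` V"
    and t: "\<And>b. b \<in> B \<Longrightarrow> continuous_on {0..1} (t b)"
    and c: "\<And>s. s \<in> {0..1} \<Longrightarrow> c s \<in> ball z R \<inter> W \<and>
            (c has_vector_derivative (\<Sum>b\<in>B. t b s *\<^sub>R X b (c s))) (at s within {0..1})"
    and s0: "s0 \<in> {0..1}" "c s0 = F u0"
  shows "\<exists>e>0. \<forall>s\<in>{0..1}. \<bar>s - s0\<bar> < e \<longrightarrow> c s \<in> F ` S"
proof -
  define A where "A = (\<lambda>u. frechet_derivative F (at u within S))"
  have inj': "inj_on (A u0) V" using inj by (simp add: A_def)
  have z: "F u0 \<in> ball z R" using c[OF s0(1)] s0(2) by simp
  obtain L where L: "linear L" "\<And>x. L x \<in> V" "\<And>v. v \<in> V \<Longrightarrow> L (A u0 v) = v"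
    and L1: "\<forall>\<^sub>F r in at_right 0. \<forall>u\<in>cball u0 r \<inter> V. \<forall>v\<in>V. norm (L (A u v) - v) \<le> norm v / 2"
    and L2: "\<forall>\<^sub>F r in at_right 0. \<exists>K\<ge>0. \<forall>u\<in>cball u0 r \<inter> V. \<forall>u'\<in>cball u0 r \<inter> V. \<forall>v\<in>V.
       norm (L (A u v) - L (A u' v)) \<le> K * norm (u - u') * norm v"
    using immersion_left_inverse[OF V S u0 F inj] unfolding A_def by blast
  have "\<forall>\<^sub>F r in at_right 0. \<exists>C. C-lipschitz_on (cball u0 r \<inter> V) (\<lambda>u. L (X b (F u)))" if "b \<in> B" for b
    using X[OF that] eventually_lipschitz_pullback[OF V S u0 F FW _ z L(1)] by blast
  then have "\<forall>\<^sub>F r in at_right 0. \<forall>b\<in>B. \<exists>C. C-lipschitz_on (cball u0 r \<inter> V) (\<lambda>u. L (X b (F u)))"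
    using B by (simp add: eventually_ball_finite)
  with L1 L2 eventually_at_right_less[of 0]
    eventually_cball_in_preimage[OF S smooth_on_continuous_on[OF F] open_ball u0 z]
  have "\<forall>\<^sub>F r in at_right 0. 0 < r \<and> (\<forall>u\<in>cball u0 r \<inter> V. u \<in> S \<and> F u \<in> ball z R) \<and>
     (\<forall>u\<in>cball u0 r \<inter> V. \<forall>v\<in>V. norm (L (A u v) - v) \<le> norm v / 2) \<and>
     (\<exists>K\<ge>0. \<forall>u\<in>cball u0 r \<inter> V. \<forall>u'\<in>cball u0 r \<inter> V. \<forall>v\<in>V.
       norm (L (A u v) - L (A u' v)) \<le> K * norm (u - u') * norm v) \<and>
     (\<forall>b\<in>B. \<exists>C. C-lipschitz_on (cball u0 r \<inter> V) (\<lambda>u. L (X b (F u))))"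
    by eventually_elim blast
  from eventually_happens'[OF trivial_limit_at_right_real this]
  obtain r where r: "0 < r" "\<And>u. u \<in> cball u0 r \<inter> V \<Longrightarrow> u \<in> S \<and> F u \<in> ball z R"
    and near: "\<And>u v. u \<in> cball u0 r \<inter> V \<Longrightarrow> v \<in> V \<Longrightarrow> norm (L (A u v) - v) \<le> norm v / 2"
    and lipA: "\<exists>K\<ge>0. \<forall>u\<in>cball u0 r \<inter> V. \<forall>u'\<in>cball u0 r \<inter> V. \<forall>v\<in>V.
       norm (L (A u v) - L (A u' v)) \<le> K * norm (u - u') * norm v"
    and lipX: "\<And>b. b \<in> B \<Longrightarrow> \<exists>C. C-lipschitz_on (cball u0 r \<inter> V) (\<lambda>u. L (X b (F u)))"
    by (elim exE conjE) (rule that, blast+)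
  define Q where "Q = cball u0 r \<inter> V"
  have bQ: "bounded Q" by (simp add: Q_def bounded_Int)
  obtain K where K: "K \<ge> 0" "\<And>u u' v. u \<in> Q \<Longrightarrow> u' \<in> Q \<Longrightarrow> v \<in> V \<Longrightarrow>
       norm (L (A u v) - L (A u' v)) \<le> K * norm (u - u') * norm v"
    using lipA unfolding Q_def by blast
  have QS: "u \<in> S" "F u \<in> ball z R" if "u \<in> Q" for u using r(2) that by (auto simp: Q_def)
  have linA: "linear (A u)" if "u \<in> Q" for u
    using smooth_on_has_derivative[OF F QS(1)[OF that]] has_derivative_linear unfolding A_def by blast
  obtain C1 G1 where CG1: "\<And>b. b \<in> B \<Longrightarrow> C1-lipschitz_on Q (\<lambda>u. L (X b (F u))) \<and>
      (\<forall>u\<in>Q. norm (L (X b (F u))) \<le> G1)"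
    using uniform_lipschitz_bounded[OF B bQ, of "\<lambda>b u. L (X b (F u))"] lipX unfolding Q_def by blast
  \<comment> \<open>The solution is to be the pullback of \<open>X b\<close> along \<open>F\<close>.
    Here its defining equation is solved only after \<open>L\<close> has been applied to both
    sides.\<close>
  have "\<exists>Y. (\<forall>u\<in>Q. Y u \<in> V \<and> L (A u (Y u)) = L (X b (F u)) \<and> norm (Y u) \<le> 2 * G1) \<and>
     (\<exists>C'. C'-lipschitz_on Q Y)" if b: "b \<in> B" for b
  proof (rule solve_near_identity[OF V, where K = K and C = C1])
    show "linear (\<lambda>w. L (A u w))" if "u \<in> Q" for u
      using linear_compose[OF linA[OF that] L(1)] by (simp add: o_def)
  qed (use near L K CG1[OF b] in \<open>auto simp: Q_def\<close>)
  then obtain Y where Y: "\<And>b u. b \<in> B \<Longrightarrow> u \<in> Q \<Longrightarrow> Y b u \<in> V \<and> L (A u (Y b u)) = L (X b (F u))"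
    and lipY: "\<And>b. b \<in> B \<Longrightarrow> \<exists>C'. C'-lipschitz_on Q (Y b)" by metis
  \<comment> \<open>\<open>L\<close> may fail to be injective on the whole space. Tangency provides
    some \<open>y\<close> in \<open>V\<close> that \<open>A u\<close> maps to
    \<open>X b (F u)\<close>, and \<open>L\<close> composed with \<open>A u\<close> is injective on
    \<open>V\<close>, so \<open>y\<close> equals \<open>Y b u\<close>.\<close>
  have FY: "A u (Y b u) = X b (F u)" if b: "b \<in> B" and u: "u \<in> Q" for b u
  proof -
    obtain y where y: "y \<in> V" "X b (F u) = A u y" using tan[OF b QS[OF u]] unfolding A_def by blast
    have "L (A u (Y b u - y)) = 0"
      using Y[OF b u] y by (simp add: linear_diff[OF linA[OF u]] linear_diff[OF L(1)])
    moreover have "Y b u - y \<in> V" using Y[OF b u] y(1) V by (simp add: subspace_diff)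
    ultimately have "norm (Y b u - y) \<le> norm (Y b u - y) / 2"
      using near[of u "Y b u - y"] u by (simp add: Q_def norm_minus_commute[of y])
    then show ?thesis using y(2) by simp
  qed
  obtain CY GY where CGY: "CY \<ge> 0" "GY \<ge> 0" "\<And>b. b \<in> B \<Longrightarrow> CY-lipschitz_on Q (Y b) \<and> (\<forall>u\<in>Q. norm (Y b u) \<le> GY)"
    using uniform_lipschitz_bounded[where X = Y, OF B bQ lipY] by blast
  obtain CX where CX: "CX \<ge> 0" "\<And>b. b \<in> B \<Longrightarrow> CX-lipschitz_on (ball z R \<inter> W) (X b)"
  proof -
    have "bounded (ball z R \<inter> W)" by (simp add: bounded_Int)
    from uniform_lipschitz_bounded[where X = X, OF B this X] show ?thesis using that by blast
  qed
  obtain T where T: "T \<ge> 0" "\<And>b s. b \<in> B \<Longrightarrow> s \<in> {0..1} \<Longrightarrow> \<bar>t b s\<bar> \<le> T"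
  proof -
    have "\<exists>T\<ge>0. \<forall>s\<in>{0..1}. \<bar>t b s\<bar> \<le> T" if "b \<in> B" for b
    proof -
      have "bounded (t b ` {0..1})"
        using compact_imp_bounded[OF compact_continuous_image[OF t[OF that]]] by simp
      then obtain T where "T > 0" "\<forall>x\<in>t b ` {0..1}. norm x \<le> T" unfolding bounded_pos by blast
      then show ?thesis by (intro exI[of _ T]) auto
    qed
    then obtain f where f: "\<And>b. b \<in> B \<Longrightarrow> f b \<ge> 0 \<and> (\<forall>s\<in>{0..1}. \<bar>t b s\<bar> \<le> f b)" by metis
    show ?thesis
    proof (rule that)
      show "sum f B \<ge> 0" using f by (simp add: sum_nonneg)
      show "\<bar>t b s\<bar> \<le> sum f B" if "b \<in> B" "s \<in> {0..1}" for b s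
      proof -
        have "f b \<le> sum f B" using f that(1) B by (intro member_le_sum) auto
        then show ?thesis using f[OF that(1)] that(2) by force
      qed
    qed
  qed
  let ?n = "real (card B)"
  \<comment> \<open>One constant dominates the speed and the Lipschitz constant of the lifted field
    as well as the Lipschitz constant of the original one; the summand 1 keeps it positive.\<close>
  define N where "N = 1 + ?n * (T * GY) + ?n * (T * CY) + ?n * (T * CX)"
  have pos: "0 \<le> ?n * (T * GY)" "0 \<le> ?n * (T * CY)" "0 \<le> ?n * (T * CX)"
    using T CGY CX by auto
  then have N: "0 < N" "?n * (T * GY) \<le> N" "?n * (T * CY) \<le> N" "?n * (T * CX) \<le> N"
    by (auto simp: N_def)
  \<comment> \<open>During a time \<open>2 * h\<close> the lifted curve stays within
    \<open>r\<close> of \<open>u0\<close>, and both equations meet the 1/2 condition.\<close>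
  define h where "h = min r (1/2) / (2 * N)"
  have h: "0 < h" using N r by (simp add: h_def)
  have hN: "2 * h * N \<le> r" "2 * h * N \<le> 1/2" using N by (auto simp: h_def)
  have hN': "2 * h * x \<le> 2 * h * N" if "x \<le> N" for x using that h by simp
  \<comment> \<open>The interval around \<open>s0\<close> is cut off at 0 and 1, so that
    \<open>s0\<close> may be an endpoint of \<open>{0..1}\<close>.\<close>
  define a where "a = max 0 (s0 - h)"
  define b where "b = min 1 (s0 + h)"
  have ab: "s0 \<in> {a..b}" "{a..b} \<subseteq> {0..1}" "b - a \<le> 2 * h" "a \<le> b" using s0 h by (auto simp: a_def b_def)
  have small: "(b - a) * x \<le> 2 * h * N" if "0 \<le> x" "x \<le> N" for x
    using mult_right_mono[OF ab(3) that(1)] hN'[OF that(2)] by simp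
  define ZY where "ZY = (\<lambda>s w. \<Sum>b\<in>B. t b s *\<^sub>R Y b w)"
  define ZX where "ZX = (\<lambda>s w. \<Sum>b\<in>B. t b s *\<^sub>R X b w)"
  have T': "\<bar>t b' s\<bar> \<le> T" if "b' \<in> B" "s \<in> {a..b}" for b' s using T(2) that ab(2) by blast
  have t': "continuous_on {a..b} (t b')" if "b' \<in> B" for b' using t[OF that] ab(2) continuous_on_subset by blast
  have cY1: "norm (ZY s w) \<le> ?n * (T * GY)" if "s \<in> {a..b}" "w \<in> Q" for s w
    unfolding ZY_def
    by (rule combination_of_fields(1)[OF B CGY(3) T' t' CGY(1) T(1) CGY(2) that])
  have cY2: "(?n * (T * CY))-lipschitz_on Q (ZY s)" if "s \<in> {a..b}" for s
    unfolding ZY_def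
    by (rule combination_of_fields(2)[OF B CGY(3) T' t' CGY(1) T(1) CGY(2) that])
  have cY3: "continuous_on ({a..b} \<times> Q) (\<lambda>(s, w). ZY s w)"
    unfolding ZY_def
    by (rule combination_of_fields(3)[OF B CGY(3) T' t' CGY(1) T(1) CGY(2)])
  have "\<exists>y. y s0 = u0 \<and> (\<forall>s\<in>{a..b}. y s \<in> cball u0 r \<inter> V \<and>
           (y has_vector_derivative ZY s (y s)) (at s within {a..b}))"
  proof (rule picard[OF V ab(1), where M = "?n * (T * GY)" and K = "?n * (T * CY)"], unfold Q_def[symmetric])
    show "ZY s w \<in> V \<and> norm (ZY s w) \<le> ?n * (T * GY)" if "s \<in> {a..b}" "w \<in> Q" for s w
      using cY1[OF that] that Y V by (auto simp: ZY_def intro!: subspace_sum subspace_scale)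
    show "u0 \<in> V" using S u0 openin_imp_subset by blast
    show "norm (u0 - u0) + (b - a) * (?n * (T * GY)) \<le> r"
      using small[OF pos(1) N(2)] hN(1) by simp
    show "(b - a) * (?n * (T * CY)) \<le> 1 / 2" using small[OF pos(2) N(3)] hN(2) by simp
  qed (use cY2 cY3 pos(1) in auto)
  then obtain y where y0: "y s0 = u0" and y: "\<And>s. s \<in> {a..b} \<Longrightarrow> y s \<in> Q \<and>
           (y has_vector_derivative ZY s (y s)) (at s within {a..b})" unfolding Q_def by blast
  have e: "F (y s) \<in> ball z R \<inter> W \<and> ((F \<circ> y) has_vector_derivative ZX s (F (y s))) (at s within {a..b})"
    if s: "s \<in> {a..b}" for s
  proof
    have yQ: "y s \<in> Q" using y[OF s] by simp
    show "F (y s) \<in> ball z R \<inter> W" using QS[OF yQ] FW by auto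
    have "A (y s) (ZY s (y s)) = ZX s (F (y s))"
      using FY[OF _ yQ] by (simp add: ZY_def ZX_def linear_sum[OF linA[OF yQ]] linear_scale[OF linA[OF yQ]])
    moreover have "(F has_derivative A (y s)) (at (y s) within y ` {a..b})"
      using smooth_on_has_derivative[OF F QS(1)[OF yQ]] y QS(1) unfolding A_def
      by (blast intro: has_derivative_subset)
    ultimately show "((F \<circ> y) has_vector_derivative ZX s (F (y s))) (at s within {a..b})"
      using vector_derivative_diff_chain_within y[OF s] by metis
  qed
  \<comment> \<open>Both curves solve the same equation in the ball and agree at \<open>s0\<close>,
    so the comparison bound is zero.\<close>
  have eq: "c s = F (y s)" if s: "s \<in> {a..b}" for s
  proof -
    have "norm (c s - (F \<circ> y) s) \<le> 2 * norm (c s0 - (F \<circ> y) s0)"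
    proof (rule lipschitz_ode_curves_close[where Z = ZX and K = "?n * (T * CX)" and S = "ball z R \<inter> W", OF _ _ _ _ ab(1) s])
      show "c s \<in> ball z R \<inter> W \<and> (c has_vector_derivative ZX s (c s)) (at s within {a..b})" if "s \<in> {a..b}" for s
        using c[of s] that ab(2) unfolding ZX_def by (blast intro: has_vector_derivative_within_subset)
      show "(?n * (T * CX))-lipschitz_on (ball z R \<inter> W) (ZX s)" if s: "s \<in> {a..b}" for s
      proof (rule lipschitz_onI)
        fix x x' assume x: "x \<in> ball z R \<inter> W" "x' \<in> ball z R \<inter> W"
        have "norm (\<Sum>b\<in>B. t b s *\<^sub>R (X b x - X b x')) \<le> ?n * (T * (CX * norm (x - x')))"
        proof (rule sum_norm_bound)
          fix b assume b: "b \<in> B"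
          have "norm (X b x - X b x') \<le> CX * norm (x - x')"
            using lipschitz_onD[OF CX(2)[OF b] x] by (simp add: dist_norm)
          then show "norm (t b s *\<^sub>R (X b x - X b x')) \<le> T * (CX * norm (x - x'))"
            using T'[OF b s] T(1) by (auto intro!: mult_mono)
        qed
        then show "dist (ZX s x) (ZX s x') \<le> ?n * (T * CX) * dist x x'"
          by (simp add: ZX_def dist_norm sum_subtractf scaleR_diff_right mult_ac)
      qed (use pos in simp)
      show "(b - a) * (?n * (T * CX)) \<le> 1 / 2" using small[OF pos(3) N(4)] hN(2) by simp
    qed (use e in \<open>auto simp: o_def\<close>)
    then show ?thesis using s0(2) y0 by simp
  qed
  have "c s \<in> F ` S" if "s \<in> {0..1}" "\<bar>s - s0\<bar> < h" for s
  proof -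
    have s: "s \<in> {a..b}" using that by (auto simp: a_def b_def)
    then show ?thesis using eq[OF s] y[OF s] QS(1) by blast
  qed
  then show ?thesis using h by blast
qed

text \<open>The velocity of the segment from \<open>u0\<close> to \<open>u1\<close> is expanded with coefficients \<open>t b\<close> in the fields
  \<open>X b\<close>; the same time-dependent equation then moves any point near \<open>F u0\<close> to a point near
  \<open>F u1\<close>.\<close>

lemma leafwise_transport:
  fixes F :: "'e::euclidean_space \<Rightarrow> 'e" and X :: "'e \<Rightarrow> 'e \<Rightarrow> 'e"
  assumes V: "subspace V" and W: "subspace W"
    and S: "openin (top_of_set V) S" and u0: "u0 \<in> S" and F: "smooth_on V S F"
    and FW: "F ` S \<subseteq> W"
    and inj: "inj_on (frechet_derivative F (at u0 within S)) V"
    and B: "finite B" "B \<subseteq> V" "\<And>b. b \<in> B \<Longrightarrow> norm b = 1" "\<And>x. x \<in> V \<Longrightarrow> (\<Sum>b\<in>B. (x \<bullet> b) *\<^sub>R b) = x"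
    and R: "0 < R"
    and X: "\<And>b. b \<in> B \<Longrightarrow> \<exists>C. C-lipschitz_on (ball (F u0) R \<inter> W) (X b)"
    and XW: "\<And>b w. b \<in> B \<Longrightarrow> w \<in> ball (F u0) R \<inter> W \<Longrightarrow> X b w \<in> W"
    and tan: "\<And>b u. b \<in> B \<Longrightarrow> u \<in> S \<Longrightarrow> F u \<in> ball (F u0) R \<Longrightarrow>
            X b (F u) \<in> frechet_derivative F (at u within S) ` V"
    and X0: "\<And>b. b \<in> B \<Longrightarrow> X b (F u0) = frechet_derivative F (at u0 within S) b"
  shows "\<exists>r>0. \<forall>u1\<in>ball u0 r \<inter> V. u1 \<in> S \<and> (\<exists>t. (\<forall>b\<in>B. continuous_on {0..1} (t b)) \<and>
     (\<exists>d>0. \<forall>w0\<in>W. norm (w0 - F u0) \<le> d \<longrightarrow> (\<exists>c. c 0 = w0 \<and>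
        (\<forall>s\<in>{0..1}. c s \<in> ball (F u0) R \<inter> W \<and>
            (c has_vector_derivative (\<Sum>b\<in>B. t b s *\<^sub>R X b (c s))) (at s within {0..1})) \<and>
        norm (c 1 - F u1) \<le> 2 * norm (w0 - F u0))))"
proof -
  define A where "A = (\<lambda>u. frechet_derivative F (at u within S))"
  define z where "z = F u0"
  have z: "F u0 \<in> ball z (R/2)" "F u0 \<in> ball (F u0) R" using R by (auto simp: z_def)
  have SV: "S \<subseteq> V" using S openin_imp_subset by blast
  obtain L where L: "linear L" "\<And>x. L x \<in> V" "\<And>v. v \<in> V \<Longrightarrow> L (A u0 v) = v"
    and L1: "\<forall>\<^sub>F r in at_right 0. \<forall>u\<in>cball u0 r \<inter> V. \<forall>v\<in>V. norm (L (A u v) - v) \<le> norm v / 2"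
    and L2: "\<forall>\<^sub>F r in at_right 0. \<exists>K\<ge>0. \<forall>u\<in>cball u0 r \<inter> V. \<forall>u'\<in>cball u0 r \<inter> V. \<forall>v\<in>V.
       norm (L (A u v) - L (A u' v)) \<le> K * norm (u - u') * norm v"
    using immersion_left_inverse[OF V S u0 F inj] unfolding A_def by blast
  \<comment> \<open>In the basis \<open>B\<close>, the columns of \<open>T u\<close> are the vectors
    \<open>L (X b (F u))\<close>. At \<open>u0\<close> it is the identity on \<open>V\<close>,
    because \<open>X b (F u0)\<close> is the image of \<open>b\<close> under the derivative.
    Inverting \<open>T u\<close> will give the coefficients of the combination.\<close>
  define T where "T = (\<lambda>u w. \<Sum>b\<in>B. (w \<bullet> b) *\<^sub>R L (X b (F u)))"
  have "\<forall>\<^sub>F r in at_right 0. \<exists>C. C-lipschitz_on (cball u0 r \<inter> V) (\<lambda>u. L (X b (F u)))" if "b \<in> B" for b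
    using X[OF that] eventually_lipschitz_pullback[OF V S u0 F FW _ z(2) L(1)] by blast
  then have lipX: "\<forall>\<^sub>F r in at_right 0. \<forall>b\<in>B. \<exists>C. C-lipschitz_on (cball u0 r \<inter> V) (\<lambda>u. L (X b (F u)))"
    using B by (simp add: eventually_ball_finite)
  define S' where "S' = {u \<in> S. F u \<in> ball (F u0) R}"
  have S': "openin (top_of_set V) S'" "u0 \<in> S'"
    unfolding S'_def using openin_preimage_continuous[OF S smooth_on_continuous_on[OF F] open_ball] u0 z(2) by auto
  \<comment> \<open>The sum vanishes at \<open>u0\<close>; below 1/2 it puts \<open>T u\<close>
    within half of the identity on \<open>V\<close>.\<close>
  have T1: "\<forall>\<^sub>F r in at_right 0. \<forall>u\<in>cball u0 r \<inter> V. u \<in> S' \<and> (\<Sum>b\<in>B. norm (L (X b (F u)) - b)) \<in> {..<1/2}"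
  proof (rule eventually_cball_in_preimage[OF S'(1) _ _ S'(2)])
    show "continuous_on S' (\<lambda>u. \<Sum>b\<in>B. norm (L (X b (F u)) - b))"
    proof (intro continuous_on_sum continuous_on_norm continuous_on_diff continuous_on_const)
      fix b assume b: "b \<in> B"
      obtain C where C: "C-lipschitz_on (ball (F u0) R \<inter> W) (X b)" using X[OF b] by blast
      have "continuous_on S' (\<lambda>u. X b (F u))"
        by (rule continuous_on_compose2[OF lipschitz_on_continuous_on[OF C]])
          (use smooth_on_continuous_on[OF F] FW in \<open>auto simp: S'_def intro: continuous_on_subset\<close>)
      then show "continuous_on S' (\<lambda>u. L (X b (F u)))"
        using linear_continuous_on_compose L(1) by blast
    qed
    have "L (X b (F u0)) = b" if "b \<in> B" for b
      using X0[OF that] L(3)[of b] B(2) that by (auto simp: A_def)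
    then show "(\<Sum>b\<in>B. norm (L (X b (F u0)) - b)) \<in> {..<1/2}" by simp
  qed simp
  from L1 L2 lipX T1 eventually_at_right_less[of 0]
    eventually_cball_in_preimage[OF S smooth_on_continuous_on[OF F] open_ball u0 z(1)]
  have "\<forall>\<^sub>F r in at_right 0. 0 < r \<and> (\<forall>u\<in>cball u0 r \<inter> V. u \<in> S \<and> F u \<in> ball z (R/2) \<and>
        (\<Sum>b\<in>B. norm (L (X b (F u)) - b)) < 1/2) \<and>
     (\<forall>u\<in>cball u0 r \<inter> V. \<forall>v\<in>V. norm (L (A u v) - v) \<le> norm v / 2) \<and>
     (\<exists>K\<ge>0. \<forall>u\<in>cball u0 r \<inter> V. \<forall>u'\<in>cball u0 r \<inter> V. \<forall>v\<in>V.
       norm (L (A u v) - L (A u' v)) \<le> K * norm (u - u') * norm v) \<and>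
     (\<forall>b\<in>B. \<exists>C. C-lipschitz_on (cball u0 r \<inter> V) (\<lambda>u. L (X b (F u))))"
    by eventually_elim auto
  from eventually_happens'[OF trivial_limit_at_right_real this]
  obtain r1 where r1: "0 < r1" "\<And>u. u \<in> cball u0 r1 \<inter> V \<Longrightarrow> u \<in> S \<and> F u \<in> ball z (R/2) \<and>
        (\<Sum>b\<in>B. norm (L (X b (F u)) - b)) < 1/2"
    and near: "\<And>u v. u \<in> cball u0 r1 \<inter> V \<Longrightarrow> v \<in> V \<Longrightarrow> norm (L (A u v) - v) \<le> norm v / 2"
    and lipA: "\<exists>K\<ge>0. \<forall>u\<in>cball u0 r1 \<inter> V. \<forall>u'\<in>cball u0 r1 \<inter> V. \<forall>v\<in>V.
       norm (L (A u v) - L (A u' v)) \<le> K * norm (u - u') * norm v"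
    and lipX: "\<And>b. b \<in> B \<Longrightarrow> \<exists>C. C-lipschitz_on (cball u0 r1 \<inter> V) (\<lambda>u. L (X b (F u)))"
    by (elim exE conjE) (rule that, blast+)
  define Q where "Q = cball u0 r1 \<inter> V"
  have bQ: "bounded Q" by (simp add: Q_def bounded_Int)
  have QV: "Q \<subseteq> V" and QS: "\<And>u. u \<in> Q \<Longrightarrow> u \<in> S" by (use r1(2) in \<open>auto simp: Q_def\<close>)
  have FQ: "F u \<in> ball z (R/2)" "F u \<in> ball (F u0) R" if "u \<in> Q" for u
    using r1(2)[of u] that R by (auto simp: Q_def z_def)
  obtain K where K: "K \<ge> 0" "\<And>u u' v. u \<in> Q \<Longrightarrow> u' \<in> Q \<Longrightarrow> v \<in> V \<Longrightarrow>
       norm (L (A u v) - L (A u' v)) \<le> K * norm (u - u') * norm v"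
    using lipA unfolding Q_def by blast
  have linA: "linear (A u)" if "u \<in> Q" for u
    using smooth_on_has_derivative[OF F QS[OF that]] has_derivative_linear unfolding A_def by blast
  obtain C1 where C1: "C1 \<ge> 0" "\<And>b. b \<in> B \<Longrightarrow> C1-lipschitz_on Q (\<lambda>u. L (X b (F u)))"
    using uniform_lipschitz_bounded[OF B(1) bQ, of "\<lambda>b u. L (X b (F u))"] lipX unfolding Q_def by blast
  have linT: "linear (T u)" for u
    unfolding T_def by (intro linear_compose_sum ballI linearI) (auto simp: inner_left_distrib scaleR_left_distrib)
  have Tnear: "T u w \<in> V \<and> norm (T u w - w) \<le> norm w / 2" if u: "u \<in> Q" and w: "w \<in> V" for u w
  proof
    show "T u w \<in> V" unfolding T_def by (intro subspace_sum subspace_scale V L(2))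
    have "T u w - w = (\<Sum>b\<in>B. (w \<bullet> b) *\<^sub>R (L (X b (F u)) - b))"
      using B(4)[OF w] by (simp add: T_def scaleR_diff_right sum_subtractf)
    also have "norm \<dots> \<le> norm w * (\<Sum>b\<in>B. norm (L (X b (F u)) - b))"
      using B(3) by (rule norm_sum_inner_scaleR_le)
    also have "\<dots> \<le> norm w * (1/2)" using r1(2)[of u] u by (intro mult_left_mono) (auto simp: Q_def)
    finally show "norm (T u w - w) \<le> norm w / 2" by simp
  qed
  have lipT: "norm (T u w - T u' w) \<le> (real (card B) * C1) * norm (u - u') * norm w"
    if u: "u \<in> Q" "u' \<in> Q" for u u' w
  proof -
    have "T u w - T u' w = (\<Sum>b\<in>B. (w \<bullet> b) *\<^sub>R (L (X b (F u)) - L (X b (F u'))))"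
      by (simp add: T_def scaleR_diff_right sum_subtractf)
    also have "norm \<dots> \<le> norm w * (\<Sum>b\<in>B. norm (L (X b (F u)) - L (X b (F u'))))"
      using B(3) by (rule norm_sum_inner_scaleR_le)
    also have "\<dots> \<le> norm w * (real (card B) * (C1 * norm (u - u')))"
      using lipschitz_onD[OF C1(2) u] by (intro mult_left_mono sum_bounded_above) (auto simp: dist_norm)
    finally show ?thesis by (simp add: mult_ac)
  qed
  \<comment> \<open>Half the radius leaves a closed ball, as \<open>picard\<close> requires, inside
    the open ball on which the fields are controlled.\<close>
  define QX where "QX = cball z (R/2) \<inter> W"
  have QX: "QX \<subseteq> ball (F u0) R \<inter> W" using R by (auto simp: QX_def z_def)
  have "bounded QX" by (simp add: QX_def bounded_Int)
  moreover have "\<exists>C. C-lipschitz_on QX (X b)" if "b \<in> B" for b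
    using X[OF that] lipschitz_on_subset QX by blast
  ultimately obtain CX GX where CGX: "CX \<ge> 0" "GX \<ge> 0" "\<And>b. b \<in> B \<Longrightarrow> CX-lipschitz_on QX (X b) \<and> (\<forall>u\<in>QX. norm (X b u) \<le> GX)"
    using uniform_lipschitz_bounded[where X = X and Q = QX, OF B(1)] by blast
  let ?n = "real (card B)"
  define N where "N = 1 + ?n * CX + ?n * GX"
  have pos: "0 \<le> ?n * CX" "0 \<le> ?n * GX" using CGX by auto
  then have N: "0 < N" "?n * CX \<le> N" "?n * GX \<le> N" by (auto simp: N_def)
  \<comment> \<open>The coefficients will be at most \<open>4 * r\<close>. With this
    \<open>r\<close> the combined field has a Lipschitz constant of at most 1/2 and moves points by
    at most \<open>R/4\<close> in unit time.\<close>
  define r where "r = min r1 (min (1/2) (R/4) / (4 * N))"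
  have r: "0 < r" "r \<le> r1" "4 * r * N \<le> 1/2" "4 * r * N \<le> R/4"
  proof -
    have "r \<le> min (1/2) (R/4) / (4 * N)" by (simp add: r_def)
    then have "4 * r * N \<le> min (1/2) (R/4)" using N(1) by (simp add: field_simps)
    then show "4 * r * N \<le> 1/2" "4 * r * N \<le> R/4" by auto
  qed (use r1 N R in \<open>auto simp: r_def\<close>)
  have rN: "4 * r * x \<le> 4 * r * N" if "x \<le> N" for x using that r(1) by simp
  show ?thesis
  proof (intro exI[of _ r] conjI ballI r(1))
    fix u1 assume u1: "u1 \<in> ball u0 r \<inter> V"
    then have u1Q: "u1 \<in> Q" using r(2) by (auto simp: Q_def)
    then show "u1 \<in> S" by (rule QS)
    define v where "v = u1 - u0"
    have vV: "v \<in> V" using u1 u0 SV V by (auto simp: v_def subspace_diff)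
    have vr: "norm v \<le> r" using u1 by (auto simp: v_def dist_norm norm_minus_commute)
    define l where "l = (\<lambda>s. u0 + s *\<^sub>R v)"
    have lQ: "l s \<in> Q" if "s \<in> {0..1}" for s
    proof -
      have "\<bar>s\<bar> * norm v \<le> 1 * r" using that vr by (intro mult_mono) auto
      then have "dist u0 (l s) \<le> r1" using r(2) by (simp add: l_def dist_norm)
      moreover have "l s \<in> V" using vV u0 SV V by (auto simp: l_def intro!: subspace_add subspace_scale)
      ultimately show ?thesis by (simp add: Q_def)
    qed
    \<comment> \<open>The coordinates of \<open>Y (l s)\<close> in the basis will be the
      coefficients at time \<open>s\<close>. Of the two factors 2 in the bound, one comes from
      \<open>L\<close> composed with \<open>A u\<close> and one from inverting
      \<open>T u\<close>.\<close>
    have "\<exists>Y. (\<forall>u\<in>Q. Y u \<in> V \<and> T u (Y u) = L (A u v) \<and> norm (Y u) \<le> 2 * (2 * norm v)) \<and> (\<exists>C'. C'-lipschitz_on Q Y)"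
    proof (rule solve_near_identity[OF V linT Tnear lipT, where C = "K * norm v"])
      fix u assume u: "u \<in> Q"
      have "norm (L (A u v)) \<le> norm v + norm (L (A u v) - v)"
        using norm_triangle_sub[of "L (A u v)" v] by simp
      also have "\<dots> \<le> 2 * norm v" using near[OF u[unfolded Q_def] vV] norm_ge_zero[of v] by linarith
      finally show "L (A u v) \<in> V \<and> norm (L (A u v)) \<le> 2 * norm v" using L(2) by blast
    next
      show "(K * norm v)-lipschitz_on Q (\<lambda>u. L (A u v))"
        by (rule lipschitz_onI) (use K vV in \<open>auto simp: dist_norm mult_ac\<close>)
    qed (use C1(1) in auto)
    then obtain Y C' where Y: "\<And>u. u \<in> Q \<Longrightarrow> Y u \<in> V \<and> T u (Y u) = L (A u v) \<and> norm (Y u) \<le> 2 * (2 * norm v)"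
      and lipY: "C'-lipschitz_on Q Y" by blast
    define t where "t = (\<lambda>b s. Y (l s) \<bullet> b)"
    have ct: "continuous_on {0..1} (t b)" for b
      unfolding t_def
    proof (intro continuous_on_inner continuous_on_const)
      show "continuous_on {0..1} (\<lambda>s. Y (l s))"
        by (rule continuous_on_compose2[OF lipschitz_on_continuous_on[OF lipY]])
          (use lQ in \<open>auto simp: l_def intro!: continuous_intros\<close>)
    qed
    have tb: "\<bar>t b s\<bar> \<le> 4 * r" if "b \<in> B" "s \<in> {0..1}" for b s
    proof -
      have "\<bar>t b s\<bar> \<le> norm (Y (l s))"
        using Cauchy_Schwarz_ineq2[of "Y (l s)" b] B(3)[OF that(1)] by (simp add: t_def)
      then show ?thesis using Y[OF lQ[OF that(2)]] vr by linarith
    qed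
    have r4: "0 \<le> 4 * r" using r(1) by simp
    define Z where "Z = (\<lambda>s w. \<Sum>b\<in>B. t b s *\<^sub>R X b w)"
    have Z1: "norm (Z s w) \<le> ?n * (4 * r * GX)" if "s \<in> {0..1}" "w \<in> QX" for s w
      unfolding Z_def
      by (rule combination_of_fields(1)[OF B(1) CGX(3) tb ct CGX(1) r4 CGX(2) that])
    have Z2: "(?n * (4 * r * CX))-lipschitz_on QX (Z s)" if "s \<in> {0..1}" for s
      unfolding Z_def
      by (rule combination_of_fields(2)[OF B(1) CGX(3) tb ct CGX(1) r4 CGX(2) that])
    have Z3: "continuous_on ({0..1} \<times> QX) (\<lambda>(s, w). Z s w)"
      unfolding Z_def
      by (rule combination_of_fields(3)[OF B(1) CGX(3) tb ct CGX(1) r4 CGX(2)])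
    have ZW: "Z s w \<in> W" if "w \<in> QX" for s w
      unfolding Z_def using that QX by (intro subspace_sum[OF W] subspace_scale[OF W] XW) auto
    have n1: "?n * (4 * r * CX) \<le> 1/2"
      using rN[OF N(2)] r(3) by (simp add: mult_ac)
    have n2: "?n * (4 * r * GX) \<le> R/4"
      using rN[OF N(3)] r(4) by (simp add: mult_ac)
    have \<gamma>: "F (l s) \<in> QX \<and> ((\<lambda>s. F (l s)) has_vector_derivative Z s (F (l s))) (at s within {0..1})"
      if s: "s \<in> {0..1}" for s
    proof
      let ?u = "l s"
      have uQ: "?u \<in> Q" using lQ[OF s] .
      show "F ?u \<in> QX" using FQ(1)[OF uQ] QS[OF uQ] FW by (auto simp: QX_def)
      have "\<forall>b\<in>B. \<exists>y. y \<in> V \<and> X b (F ?u) = A ?u y"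
        using tan[OF _ QS[OF uQ] FQ(2)[OF uQ]] unfolding A_def by blast
      then obtain y where y: "\<And>b. b \<in> B \<Longrightarrow> y b \<in> V \<and> X b (F ?u) = A ?u (y b)" by metis
      define v' where "v' = (\<Sum>b\<in>B. t b s *\<^sub>R y b)"
      have v'V: "v' \<in> V" unfolding v'_def using y V by (intro subspace_sum subspace_scale) auto
      have Av': "A ?u v' = Z s (F ?u)"
        using y by (simp add: v'_def Z_def linear_sum[OF linA[OF uQ]] linear_scale[OF linA[OF uQ]])
      \<comment> \<open>The coefficients were chosen so that the velocities agree under
        \<open>L\<close>. By tangency the combination is \<open>A ?u v'\<close> with
        \<open>v'\<close> in \<open>V\<close>, and injectivity of \<open>L\<close> composed with
        \<open>A ?u\<close> on \<open>V\<close> then gives \<open>v' = v\<close>.\<close>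
      have "L (A ?u v') = T ?u (Y ?u)"
        unfolding Av' by (simp add: Z_def T_def t_def linear_sum[OF L(1)] linear_scale[OF L(1)])
      also have "\<dots> = L (A ?u v)" using Y[OF uQ] by blast
      finally have "L (A ?u (v' - v)) = 0"
        by (simp add: linear_diff[OF linA[OF uQ]] linear_diff[OF L(1)])
      moreover have "v' - v \<in> V" using v'V vV V by (simp add: subspace_diff)
      ultimately have "v' = v" using near[of ?u "v' - v"] uQ by (simp add: Q_def norm_minus_commute[of v])
      moreover have "(l has_vector_derivative v) (at s within {0..1})"
        unfolding l_def by (auto intro!: derivative_eq_intros)
      moreover have "(F has_derivative A ?u) (at ?u within l ` {0..1})"
        using smooth_on_has_derivative[OF F QS[OF uQ]] lQ QS unfolding A_def
        by (blast intro: has_derivative_subset)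
      ultimately show "((\<lambda>s. F (l s)) has_vector_derivative Z s (F (l s))) (at s within {0..1})"
        using vector_derivative_diff_chain_within[of l v s "{0..1}" F "A ?u"] Av' by (simp add: o_def)
    qed
    show "\<exists>t. (\<forall>b\<in>B. continuous_on {0..1} (t b)) \<and>
     (\<exists>d>0. \<forall>w0\<in>W. norm (w0 - F u0) \<le> d \<longrightarrow> (\<exists>c. c 0 = w0 \<and>
        (\<forall>s\<in>{0..1}. c s \<in> ball (F u0) R \<inter> W \<and>
            (c has_vector_derivative (\<Sum>b\<in>B. t b s *\<^sub>R X b (c s))) (at s within {0..1})) \<and>
        norm (c 1 - F u1) \<le> 2 * norm (w0 - F u0)))"
    \<comment> \<open>An initial distance of \<open>R/4\<close> and a displacement of
      \<open>R/4\<close> add up to the radius \<open>R/2\<close> of \<open>QX\<close>.\<close>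
    proof (intro exI[of _ t] exI[of _ "R/4"] conjI ballI impI)
      show "0 < R/4" using R by simp
      fix w0 assume w0: "w0 \<in> W" "norm (w0 - F u0) \<le> R/4"
      have "\<exists>c. c 0 = w0 \<and> (\<forall>s\<in>{0..1}. c s \<in> cball z (R/2) \<inter> W \<and>
           (c has_vector_derivative Z s (c s)) (at s within {0..1}))"
        by (rule picard[OF W, where M = "?n * (4 * r * GX)" and K = "?n * (4 * r * CX)"], unfold QX_def[symmetric])
          (use Z1 Z2 Z3 ZW n1 n2 w0 r4 CGX in \<open>auto simp: z_def\<close>)
      then obtain c where c0: "c 0 = w0" and c: "\<And>s. s \<in> {0..1} \<Longrightarrow> c s \<in> QX \<and>
           (c has_vector_derivative Z s (c s)) (at s within {0..1})" unfolding QX_def by blast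
      have "norm (c 1 - F (l 1)) \<le> 2 * norm (c 0 - F (l 0))"
        by (rule lipschitz_ode_curves_close[where Z = Z and S = QX, OF c \<gamma> Z2]) (use n1 in auto)
      then have "norm (c 1 - F u1) \<le> 2 * norm (w0 - F u0)" by (simp add: c0 l_def v_def)
      with c0 c QX show "\<exists>c. c 0 = w0 \<and>
        (\<forall>s\<in>{0..1}. c s \<in> ball (F u0) R \<inter> W \<and>
            (c has_vector_derivative (\<Sum>b\<in>B. t b s *\<^sub>R X b (c s))) (at s within {0..1})) \<and>
        norm (c 1 - F u1) \<le> 2 * norm (w0 - F u0)"
        unfolding Z_def by blast
    qed (rule ct)
  qed
qed

subsection \<open>Charts and tangent vectors\<close>

text \<open>On the line through \<open>u\<close> in direction \<open>v\<close> the question concerns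
  one real variable: as \<open>S\<close> is relatively open, the parameters that stay in
  \<open>S\<close> form an open set around 0, where vector derivatives are unique.\<close>

lemma derivative_unique_in_subspace:
  fixes f :: "'e::euclidean_space \<Rightarrow> 'e"
  assumes V: "subspace V" and S: "openin (top_of_set V) S" and u: "u \<in> S"
    and A: "(f has_derivative A) (at u within S)" "(f has_derivative A') (at u within S)" and v: "v \<in> V"
  shows "A v = A' v"
proof -
  define l where "l = (\<lambda>t::real. u + t *\<^sub>R v)"
  have SV: "S \<subseteq> V" using S openin_imp_subset by blast
  have l: "continuous_on UNIV l" unfolding l_def by (intro continuous_intros)
  have lV: "l \<in> UNIV \<rightarrow> V" using u v SV V by (auto simp: l_def intro!: subspace_add subspace_scale)
  define T where "T = l -` S"
  have "openin (top_of_set UNIV) (UNIV \<inter> l -` S)"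
    using continuous_openin_preimage[OF l lV S] .
  then have T: "open T" "0 \<in> T" using u by (auto simp: T_def l_def)
  have "(f \<circ> l has_vector_derivative A v) (at 0)"
    if "(f has_derivative A) (at u within S)" for A
  proof -
    have "(l has_vector_derivative v) (at 0 within T)" unfolding l_def by (auto intro!: derivative_eq_intros)
    moreover have "(f has_derivative A) (at (l 0) within l ` T)"
      using that by (auto simp: l_def T_def intro: has_derivative_subset)
    ultimately have "(f \<circ> l has_vector_derivative A v) (at 0 within T)"
      by (rule vector_derivative_diff_chain_within)
    then show ?thesis using at_within_open[OF T(2,1)] by simp
  qed
  from this[OF A(1)] this[OF A(2)] show ?thesis by (rule vector_derivative_unique_at)
qed

text \<open>Composition with the projection onto \<open>W\<close> does not change \<open>f\<close>
  on \<open>S\<close>, so uniqueness of the derivative equates \<open>A v\<close> with its own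
  projection.\<close>

lemma derivative_in_subspace:
  fixes f :: "'e::euclidean_space \<Rightarrow> 'e"
  assumes V: "subspace V" and W: "subspace W" and S: "openin (top_of_set V) S" and u: "u \<in> S"
    and A: "(f has_derivative A) (at u within S)" and fW: "f ` S \<subseteq> W" and v: "v \<in> V"
  shows "A v \<in> W"
proof -
  obtain B where B: "finite B" "B \<subseteq> W" "\<And>x. x \<in> W \<Longrightarrow> (\<Sum>b\<in>B. (x \<bullet> b) *\<^sub>R b) = x"
    using subspace_orthonormal_basis[OF W] by metis
  define p where "p = (\<lambda>x::'e. \<Sum>b\<in>B. (x \<bullet> b) *\<^sub>R b)"
  have blp: "bounded_linear p"
    unfolding p_def by (intro bounded_linear_sum bounded_linear_intros)
  have "((\<lambda>x. p (f x)) has_derivative (\<lambda>x. p (A x))) (at u within S)"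
    using bounded_linear.has_derivative[OF blp A] .
  then have "(f has_derivative (\<lambda>x. p (A x))) (at u within S)"
    by (rule has_derivative_transform[OF u, rotated]) (use fW B(3) in \<open>auto simp: p_def\<close>)
  then have "A v = p (A v)" using derivative_unique_in_subspace[OF V S u A _ v] by blast
  moreover have "p (A v) \<in> W" unfolding p_def using B(2) by (intro subspace_sum[OF W] subspace_scale[OF W]) auto
  ultimately show ?thesis by simp
qed

section \<open>Charts and changes of coordinates\<close>

lemma is_chart_inj_on: "is_chart X V c \<Longrightarrow> inj_on (snd c) (fst c)"
  unfolding is_chart_def
  by (metis homeomorphic_imp_injective_map openin_subset topspace_subtopology_subset)

lemma is_chart_image_open:
  assumes c: "is_chart X V c" and U: "openin X U"
  shows "openin (top_of_set V) (snd c ` (fst c \<inter> U))"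
proof -
  have "openin (subtopology X (fst c)) (fst c \<inter> U)"
    using U by (simp add: openin_subtopology_Int2)
  then have "openin (top_of_set (snd c ` fst c)) (snd c ` (fst c \<inter> U))"
    using c homeomorphic_imp_open_map unfolding is_chart_def open_map_def by blast
  then show ?thesis using c openin_trans unfolding is_chart_def by blast
qed

lemma is_chart_vimage_open:
  assumes c: "is_chart X V c" and T: "openin (top_of_set V) T"
  shows "openin X {x \<in> fst c. snd c x \<in> T}"
proof -
  let ?I = "snd c ` fst c"
  have "?I \<subseteq> V" using c openin_imp_subset unfolding is_chart_def by blast
  then have "openin (top_of_set ?I) (?I \<inter> T)"
    using T by (metis openin_subtopology_Int2 inf.absorb_iff2 subtopology_subtopology)
  moreover have "continuous_map (subtopology X (fst c)) (top_of_set ?I) (snd c)"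
    using c homeomorphic_imp_continuous_map unfolding is_chart_def by blast
  ultimately have "openin (subtopology X (fst c)) {x \<in> topspace (subtopology X (fst c)). snd c x \<in> ?I \<inter> T}"
    using openin_continuous_map_preimage by blast
  moreover have X: "openin X (fst c)" using c unfolding is_chart_def by blast
  ultimately have "openin X {x \<in> topspace (subtopology X (fst c)). snd c x \<in> ?I \<inter> T}"
    by (simp add: openin_open_subtopology)
  moreover have "{x \<in> topspace (subtopology X (fst c)). snd c x \<in> ?I \<inter> T} = {x \<in> fst c. snd c x \<in> T}"
    using openin_subset[OF X] by auto
  ultimately show ?thesis by simp
qed

lemma coord_dom_id: "coord_dom id c d = snd c ` (fst c \<inter> fst d)"
  by (auto simp: coord_dom_def)

lemma coord_rep_id: "inj_on (snd c) (fst c) \<Longrightarrow> x \<in> fst c \<Longrightarrow> coord_rep id c d (snd c x) = snd d x"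
  by (simp add: coord_rep_def)

lemma coord_rep_id_image:
  "inj_on (snd c) (fst c) \<Longrightarrow> coord_rep id c d ` coord_dom id c d = snd d ` (fst c \<inter> fst d)"
  by (force simp: coord_dom_id coord_rep_id image_iff)

lemma coord_deriv_chain:
  fixes c c' d :: "('a, 'e::euclidean_space) chart"
  assumes V: "subspace V" and c: "is_chart X V c" "is_chart X V c'"
    and d: "openin X (fst c \<inter> fst d)"
    and sm: "smooth_on V (coord_dom id c c') (coord_rep id c c')"
      "smooth_on V (coord_dom id c' d) (coord_rep id c' d)"
      "smooth_on V (coord_dom id c d) (coord_rep id c d)"
    and x: "x \<in> fst c" "x \<in> fst c'" "x \<in> fst d" and v: "v \<in> V"
  shows "coord_deriv id c d x v = coord_deriv id c' d x (coord_deriv id c c' x v)"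
proof -
  note inj = c[THEN is_chart_inj_on]
  have op: "openin X (fst c \<inter> fst d \<inter> fst c')" using d c(2) by (auto simp: is_chart_def)
  define U where "U = snd c ` (fst c \<inter> (fst c \<inter> fst d \<inter> fst c'))"
  have U: "openin (top_of_set V) U" unfolding U_def by (rule is_chart_image_open[OF c(1) op])
  have xU: "snd c x \<in> U" using x by (auto simp: U_def)
  have 1: "(coord_rep id c d has_derivative coord_deriv id c d x) (at (snd c x) within U)"
    unfolding coord_deriv_def
    by (rule has_derivative_subset[OF smooth_on_has_derivative[OF sm(3)]])
      (use x in \<open>auto simp: U_def coord_dom_id\<close>)
  have 2: "(coord_rep id c c' has_derivative coord_deriv id c c' x) (at (snd c x) within U)"
    unfolding coord_deriv_def
    by (rule has_derivative_subset[OF smooth_on_has_derivative[OF sm(1)]])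
      (use x in \<open>auto simp: U_def coord_dom_id\<close>)
  have 3: "(coord_rep id c' d has_derivative coord_deriv id c' d x)
      (at (coord_rep id c c' (snd c x)) within coord_rep id c c' ` U)"
    unfolding coord_deriv_def coord_rep_id[OF inj(1) x(1)]
    by (rule has_derivative_subset[OF smooth_on_has_derivative[OF sm(2)]])
      (use x in \<open>auto simp: U_def coord_dom_id coord_rep_id inj\<close>)
  have "(coord_rep id c' d \<circ> coord_rep id c c' has_derivative coord_deriv id c' d x \<circ> coord_deriv id c c' x)
      (at (snd c x) within U)"
    by (rule diff_chain_within[OF 2 3])
  then have "(coord_rep id c d has_derivative coord_deriv id c' d x \<circ> coord_deriv id c c' x) (at (snd c x) within U)"
    by (rule has_derivative_transform[OF xU, rotated]) (auto simp: U_def coord_rep_id inj)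
  from derivative_unique_in_subspace[OF V U xU 1 this v] show ?thesis by simp
qed

lemma coord_deriv_self:
  fixes c :: "('a, 'e::euclidean_space) chart"
  assumes V: "subspace V" and c: "is_chart X V c" and x: "x \<in> fst c" and v: "v \<in> V"
    and sm: "smooth_on V (coord_dom id c c) (coord_rep id c c)"
  shows "coord_deriv id c c x v = v"
proof -
  note inj = is_chart_inj_on[OF c]
  have U: "openin (top_of_set V) (coord_dom id c c)" "snd c x \<in> coord_dom id c c"
    using c x by (auto simp: coord_dom_id is_chart_def)
  have "((\<lambda>u. u) has_derivative (\<lambda>v. v)) (at (snd c x) within coord_dom id c c)"
    by (rule has_derivative_ident)
  then have "(coord_rep id c c has_derivative (\<lambda>v. v)) (at (snd c x) within coord_dom id c c)"
    by (rule has_derivative_transform[OF U(2), rotated]) (auto simp: coord_dom_id coord_rep_id inj)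
  then show ?thesis
    using derivative_unique_in_subspace[OF V U smooth_on_has_derivative[OF sm U(2)] _ v]
    unfolding coord_deriv_def by blast
qed

lemma smooth_manifoldD:
  assumes "smooth_manifold M"
  shows "subspace (model M)" "c \<in> atlas M \<Longrightarrow> is_chart (mtop M) (model M) c"
    "x \<in> points M \<Longrightarrow> \<exists>c. c \<in> charts_at M x"
    "c \<in> charts_at M x \<Longrightarrow> x \<in> points M"
    "c \<in> atlas M \<Longrightarrow> d \<in> atlas M \<Longrightarrow> smooth_on (model M) (coord_dom id c d) (coord_rep id c d)"
  using assms unfolding smooth_manifold_def charts_at_def by blast+

text \<open>The vector \<open>v\<close> is transported from \<open>c\<close> to every chart at
  \<open>x\<close>, and the chain rule makes the resulting family compatible. Hence evaluation in a
  single chart maps the tangent space onto the model space.\<close>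

lemma tangent_vector_exists:
  fixes M :: "('a, 'e::euclidean_space) manifold"
  assumes M: "smooth_manifold M" and c: "c \<in> charts_at M x" and v: "v \<in> model M"
  shows "\<exists>\<xi>\<in>tangent_space M x. \<xi> c = v"
proof -
  note M' = smooth_manifoldD[OF M]
  have ch: "d \<in> atlas M" "x \<in> fst d" if "d \<in> charts_at M x" for d using that by (auto simp: charts_at_def)
  have op: "openin (mtop M) (fst c \<inter> fst d)" if "d \<in> atlas M" for d
    using M'(2)[OF that] M'(2)[OF ch(1)[OF c]] by (auto simp: is_chart_def)
  define \<xi> where "\<xi> = (\<lambda>d. if d \<in> charts_at M x then coord_deriv id c d x v else 0)"
  have "\<xi> d \<in> model M" if d: "d \<in> charts_at M x" for d
  proof -
    have U: "openin (top_of_set (model M)) (coord_dom id c d)" "snd c x \<in> coord_dom id c d"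
      using is_chart_image_open[OF M'(2)[OF ch(1)[OF c]] op[OF ch(1)[OF d]]] ch[OF c] ch[OF d]
      by (auto simp: coord_dom_id Int_left_commute)
    have "coord_rep id c d ` coord_dom id c d \<subseteq> model M"
      using coord_rep_id_image[OF is_chart_inj_on[OF M'(2)[OF ch(1)[OF c]]], of d] M'(2)[OF ch(1)[OF d]] openin_imp_subset
      unfolding is_chart_def by blast
    from derivative_in_subspace[OF M'(1) M'(1) U smooth_on_has_derivative[OF M'(5) U(2)] this v]
    show ?thesis using d ch[OF c] ch[OF d] by (simp add: \<xi>_def coord_deriv_def)
  qed
  moreover have "\<xi> e = coord_deriv id d e x (\<xi> d)" if d: "d \<in> charts_at M x" and e: "e \<in> charts_at M x" for d e
    using coord_deriv_chain[OF M'(1) M'(2)[OF ch(1)[OF c]] M'(2)[OF ch(1)[OF d]] op[OF ch(1)[OF e]]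
        M'(5) M'(5) M'(5) ch(2)[OF c] ch(2)[OF d] ch(2)[OF e] v] d e ch c
    by (simp add: \<xi>_def)
  moreover have "\<xi> d = 0" if "d \<notin> charts_at M x" for d using that by (simp add: \<xi>_def)
  ultimately have "\<xi> \<in> tangent_space M x" unfolding tangent_space_def by blast
  moreover have "\<xi> c = v"
    using coord_deriv_self[OF M'(1) M'(2)[OF ch(1)[OF c]] ch(2)[OF c] v M'(5)] c ch by (simp add: \<xi>_def)
  ultimately show ?thesis by blast
qed

section \<open>Immersed submanifolds and tangent spaces of leaves in coordinates\<close>

lemma immersed_submanifoldD:
  fixes P N :: "('a, 'e::euclidean_space) manifold"
  assumes P: "smooth_manifold P" and N: "immersed_submanifold P N"
  shows "smooth_manifold N" "points N \<subseteq> points P"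
    "openin (mtop P) U \<Longrightarrow> openin (mtop N) (points N \<inter> U)"
    "c \<in> atlas N \<Longrightarrow> d \<in> atlas P \<Longrightarrow> openin (mtop N) (fst c \<inter> fst d)"
    "c \<in> atlas N \<Longrightarrow> d \<in> atlas P \<Longrightarrow> openin (top_of_set (model N)) (coord_dom id c d)"
    "c \<in> atlas N \<Longrightarrow> d \<in> atlas P \<Longrightarrow> smooth_on (model N) (coord_dom id c d) (coord_rep id c d)"
    "c \<in> atlas N \<Longrightarrow> d \<in> atlas P \<Longrightarrow> coord_rep id c d ` coord_dom id c d \<subseteq> model P"
proof -
  show N1: "smooth_manifold N" and "points N \<subseteq> points P"
    and "c \<in> atlas N \<Longrightarrow> d \<in> atlas P \<Longrightarrow> smooth_on (model N) (coord_dom id c d) (coord_rep id c d)"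
    using N by (auto simp: immersed_submanifold_def immersion_def smooth_map_def)
  have "continuous_map (mtop N) (mtop P) id"
    using N by (simp add: immersed_submanifold_def immersion_def smooth_map_def)
  then have op: "openin (mtop N) (points N \<inter> U)" if "openin (mtop P) U" for U
    using that by (auto simp: continuous_map_def Int_def)
  then show "openin (mtop P) U \<Longrightarrow> openin (mtop N) (points N \<inter> U)" .
  assume c: "c \<in> atlas N" and d: "d \<in> atlas P"
  have c': "is_chart (mtop N) (model N) c" and d': "is_chart (mtop P) (model P) d"
    using smooth_manifoldD(2) N1 P c d by blast+
  have "openin (mtop N) (fst c \<inter> (points N \<inter> fst d))"
    using c' d' op by (auto simp: is_chart_def)
  moreover have "fst c \<subseteq> points N" using c' openin_subset by (auto simp: is_chart_def)
  ultimately show *: "openin (mtop N) (fst c \<inter> fst d)"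
    by (metis Int_absorb2 inf_assoc)
  show "openin (top_of_set (model N)) (coord_dom id c d)"
    using is_chart_image_open[OF c' *] by (simp add: coord_dom_id Int_left_commute)
  show "coord_rep id c d ` coord_dom id c d \<subseteq> model P"
    using coord_rep_id_image[OF is_chart_inj_on[OF c'], of d] d' openin_imp_subset
    unfolding is_chart_def by blast
qed

text \<open>The lemmas on curves need tangency and the immersion condition in charts, whereas the
  definitions speak of tangent vectors. Evaluation at \<open>c\<close> maps onto the model space,
  and the component at \<open>d\<close> determines a vector tangent to \<open>P\<close>, so both
  conditions carry over.\<close>

lemma integral_manifold_tangent:
  fixes P N :: "('a, 'e::euclidean_space) manifold"
  assumes P: "smooth_manifold P" and D: "smooth_distribution P D"
    and N: "connected_integral_manifold P D N"
    and c: "c \<in> charts_at N x" and d: "d \<in> charts_at P x"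
  shows "(\<lambda>\<xi>. \<xi> d) ` D x = coord_deriv id c d x ` model N"
    and "inj_on (coord_deriv id c d x) (model N)"
proof -
  have NP: "immersed_submanifold P N" using N by (simp add: connected_integral_manifold_def)
  note N' = immersed_submanifoldD[OF P NP]
  note M' = smooth_manifoldD[OF N'(1)]
  have xN: "x \<in> points N" using M'(4) c by blast
  then have xP: "x \<in> points P" using N' by blast
  have Dx: "differential N P id x ` tangent_space N x = D x"
    using N xN by (simp add: connected_integral_manifold_def)
  have DT: "D x \<subseteq> tangent_space P x" using D xP unfolding smooth_distribution_def by blast
  have inj: "inj_on (differential N P id x) (tangent_space N x)"
    using NP xN by (simp add: immersed_submanifold_def immersion_def)
  have ch: "d \<in> atlas P" "x \<in> fst d" using d by (auto simp: charts_at_def)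
  have chN: "c \<in> atlas N" "x \<in> fst c" if "c \<in> charts_at N x" for c using that by (auto simp: charts_at_def)
  \<comment> \<open>\<open>differential\<close> reads its argument in a chosen chart
    \<open>c0\<close>; the chain rule replaces it by the given \<open>c\<close>.\<close>
  have dif: "differential N P id x \<xi> d = coord_deriv id c d x (\<xi> c)" if \<xi>: "\<xi> \<in> tangent_space N x" for \<xi>
  proof -
    define c0 where "c0 = (SOME c. c \<in> charts_at N x)"
    have c0: "c0 \<in> charts_at N x" unfolding c0_def using c by (rule someI)
    have "\<xi> c0 = coord_deriv id c c0 x (\<xi> c)" "\<xi> c \<in> model N"
      using \<xi> c c0 unfolding tangent_space_def by blast+
    moreover from this(2) have "coord_deriv id c d x (\<xi> c) = coord_deriv id c0 d x (coord_deriv id c c0 x (\<xi> c))"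
      by (intro coord_deriv_chain[where X = "mtop N" and V = "model N"] M' N'(4,6) chN c c0 ch)
    ultimately show ?thesis using d by (simp add: differential_def c0_def[symmetric] Let_def)
  qed
  have model: "(\<lambda>\<xi>. \<xi> c) ` tangent_space N x = model N"
  proof (intro equalityI subsetI)
    fix v assume "v \<in> model N"
    then obtain \<xi> where "\<xi> \<in> tangent_space N x" "\<xi> c = v" using tangent_vector_exists[OF N'(1) c] by blast
    then show "v \<in> (\<lambda>\<xi>. \<xi> c) ` tangent_space N x" by blast
  next
    fix v assume "v \<in> (\<lambda>\<xi>. \<xi> c) ` tangent_space N x"
    then obtain \<xi> where "\<xi> \<in> tangent_space N x" "v = \<xi> c" by blast
    then show "v \<in> model N" using c unfolding tangent_space_def by blast
  qed
  have "(\<lambda>\<xi>. \<xi> d) ` D x = (\<lambda>\<xi>. coord_deriv id c d x (\<xi> c)) ` tangent_space N x"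
    unfolding Dx[symmetric] image_image by (intro image_cong refl dif)
  also have "\<dots> = coord_deriv id c d x ` model N" unfolding model[symmetric] image_image ..
  finally show "(\<lambda>\<xi>. \<xi> d) ` D x = coord_deriv id c d x ` model N" .
  show "inj_on (coord_deriv id c d x) (model N)"
  proof (rule inj_onI)
    fix v w assume v: "v \<in> model N" and w: "w \<in> model N" and eq: "coord_deriv id c d x v = coord_deriv id c d x w"
    obtain \<xi> where \<xi>: "\<xi> \<in> tangent_space N x" "\<xi> c = v" using tangent_vector_exists[OF N'(1) c v] by blast
    obtain \<eta> where \<eta>: "\<eta> \<in> tangent_space N x" "\<eta> c = w" using tangent_vector_exists[OF N'(1) c w] by blast
    have d\<xi>: "differential N P id x \<xi> \<in> tangent_space P x" and d\<eta>: "differential N P id x \<eta> \<in> tangent_space P x"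
      using \<xi> \<eta> Dx DT by auto
    have "differential N P id x \<xi> e = differential N P id x \<eta> e" for e
    proof (cases "e \<in> charts_at P x")
      case True
      then have "\<zeta> e = coord_deriv id d e x (\<zeta> d)" if "\<zeta> \<in> tangent_space P x" for \<zeta>
        using d that unfolding tangent_space_def by blast
      then show ?thesis using d\<xi> d\<eta> dif[OF \<xi>(1)] dif[OF \<eta>(1)] eq \<xi>(2) \<eta>(2) by metis
    qed (simp add: differential_def)
    then have "differential N P id x \<xi> = differential N P id x \<eta>" by (rule ext)
    then have "\<xi> = \<eta>" by (rule inj_onD[OF inj _ \<xi>(1) \<eta>(1)])
    then show "v = w" using \<xi>(2) \<eta>(2) by simp
  qed
qed

subsection \<open>Openness of the leaf projection\<close>

text \<open>A field of subspaces over coordinates, matching the equations in the model space; it is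
  meaningful only on the image of the chart.\<close>

definition coord_distribution ::
  "('a, 'e::euclidean_space) distribution \<Rightarrow> ('a, 'e) chart \<Rightarrow> 'e \<Rightarrow> 'e set" where
  "coord_distribution D d w = (\<lambda>\<xi>. \<xi> d) ` D (inv_into (fst d) (snd d) w)"

lemma coord_distribution_at:
  "inj_on (snd d) (fst d) \<Longrightarrow> x \<in> fst d \<Longrightarrow> coord_distribution D d (snd d x) = (\<lambda>\<xi>. \<xi> d) ` D x"
  by (simp add: coord_distribution_def)

lemma smooth_distributionD:
  assumes "smooth_distribution P D" "x \<in> points P"
  shows "subspace (D x)" "D x \<subseteq> tangent_space P x"
    "D x = span {X x | X W. smooth_local_section P D W X \<and> x \<in> W}"
  using assms unfolding smooth_distribution_def by blast+

lemma coord_distribution_subspace: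
  fixes P :: "('a, 'e::euclidean_space) manifold"
  assumes P: "smooth_manifold P" and D: "smooth_distribution P D" and d: "d \<in> atlas P" and w: "w \<in> snd d ` fst d"
  shows "subspace (coord_distribution D d w)" "coord_distribution D d w \<subseteq> model P"
proof -
  define y where "y = inv_into (fst d) (snd d) w"
  have y: "d \<in> charts_at P y" using inv_into_into[OF w] d by (simp add: y_def charts_at_def)
  then have yP: "y \<in> points P" using smooth_manifoldD(4)[OF P] by blast
  note Dy = smooth_distributionD[OF D yP]
  have "linear (\<lambda>\<xi>::('a, 'e) tangent_vector. \<xi> d)"
    by (rule linearI) (auto simp: plus_fun_def scaleR_fun_def)
  then show "subspace (coord_distribution D d w)"
    unfolding coord_distribution_def y_def[symmetric] using Dy(1) by (rule linear_subspace_image)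
  show "coord_distribution D d w \<subseteq> model P"
    using Dy(2) y unfolding coord_distribution_def y_def[symmetric] tangent_space_def by blast
qed

text \<open>\<open>D z\<close> is only spanned by values of local sections, so the argument is an
  induction over the span: sections are smooth, hence locally Lipschitz, and sums and multiples stay
  in \<open>D\<close> because its fibres are subspaces. Sections have different domains; the
  eventual form lets the radius shrink in each step.\<close>

lemma local_lipschitz_field:
  fixes P :: "('a, 'e::euclidean_space) manifold"
  assumes P: "smooth_manifold P" and D: "smooth_distribution P D" and d: "d \<in> charts_at P z"
    and \<xi>: "\<xi> \<in> D z"
  shows "\<exists>X. X (snd d z) = \<xi> d \<and> (\<forall>\<^sub>F R in at_right 0. (\<exists>C. C-lipschitz_on (cball (snd d z) R \<inter> model P) X) \<and>
            (\<forall>w\<in>cball (snd d z) R \<inter> model P. w \<in> snd d ` fst d \<and> X w \<in> coord_distribution D d w))"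
    (is "?P \<xi>")
proof -
  have dP: "d \<in> atlas P" "z \<in> fst d" using d by (auto simp: charts_at_def)
  note ch = smooth_manifoldD(2)[OF P dP(1)]
  have V: "subspace (model P)" using smooth_manifoldD(1)[OF P] .
  have zP: "z \<in> points P" using smooth_manifoldD(4)[OF P] d by blast
  note inj = is_chart_inj_on[OF ch]
  have I: "openin (top_of_set (model P)) (snd d ` fst d)" using ch by (simp add: is_chart_def)
  have ev: "\<forall>\<^sub>F R in at_right 0. \<forall>w\<in>cball (snd d z) R \<inter> model P. w \<in> snd d ` fst d"
    using eventually_cball_Int_subset[OF I, of "snd d z"] dP by (auto elim: eventually_mono)
  have "\<xi> \<in> span {X z | X W. smooth_local_section P D W X \<and> z \<in> W}"
    using \<xi> smooth_distributionD(3)[OF D zP] by metis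
  then show ?thesis
  proof (rule span_induct)
    show "subspace (Collect ?P)"
    proof (rule subspaceI; unfold mem_Collect_eq)
      have "0 \<in> coord_distribution D d w" if "w \<in> snd d ` fst d" for w
        using coord_distribution_subspace(1)[OF P D dP(1) that] by (rule subspace_0)
      then show "?P 0"
        using ev by (intro exI[of _ "\<lambda>w. 0"]) (auto simp: zero_fun_def elim!: eventually_mono intro: lipschitz_on_constant)
    next
      fix \<xi> \<eta> assume "?P \<xi>" "?P \<eta>"
      then obtain X Y where XY: "X (snd d z) = \<xi> d" "Y (snd d z) = \<eta> d"
        and ev: "\<forall>\<^sub>F R in at_right 0. (\<exists>C. C-lipschitz_on (cball (snd d z) R \<inter> model P) X) \<and>
            (\<forall>w\<in>cball (snd d z) R \<inter> model P. w \<in> snd d ` fst d \<and> X w \<in> coord_distribution D d w)"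
          "\<forall>\<^sub>F R in at_right 0. (\<exists>C. C-lipschitz_on (cball (snd d z) R \<inter> model P) Y) \<and>
            (\<forall>w\<in>cball (snd d z) R \<inter> model P. w \<in> snd d ` fst d \<and> Y w \<in> coord_distribution D d w)"
        by blast
      have "\<forall>\<^sub>F R in at_right 0. (\<exists>C. C-lipschitz_on (cball (snd d z) R \<inter> model P) (\<lambda>w. X w + Y w)) \<and>
            (\<forall>w\<in>cball (snd d z) R \<inter> model P. w \<in> snd d ` fst d \<and> X w + Y w \<in> coord_distribution D d w)"
        using ev
      proof eventually_elim
        case (elim R)
        then show ?case
          using lipschitz_on_add coord_distribution_subspace(1)[OF P D dP(1)] subspace_add by blast
      qed
      then show "?P (\<xi> + \<eta>)" using XY by (intro exI[of _ "\<lambda>w. X w + Y w"]) (simp add: plus_fun_def)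
    next
      fix a \<xi> assume "?P \<xi>"
      then obtain X where X: "X (snd d z) = \<xi> d"
        and ev: "\<forall>\<^sub>F R in at_right 0. (\<exists>C. C-lipschitz_on (cball (snd d z) R \<inter> model P) X) \<and>
            (\<forall>w\<in>cball (snd d z) R \<inter> model P. w \<in> snd d ` fst d \<and> X w \<in> coord_distribution D d w)"
        by blast
      have "\<forall>\<^sub>F R in at_right 0. (\<exists>C. C-lipschitz_on (cball (snd d z) R \<inter> model P) (\<lambda>w. a *\<^sub>R X w)) \<and>
            (\<forall>w\<in>cball (snd d z) R \<inter> model P. w \<in> snd d ` fst d \<and> a *\<^sub>R X w \<in> coord_distribution D d w)"
        using ev
      proof eventually_elim
        case (elim R)
        then show ?case
          using lipschitz_on_cmult coord_distribution_subspace(1)[OF P D dP(1)] subspace_scale by blast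
      qed
      then show "?P (a *\<^sub>R \<xi>)" using X by (intro exI[of _ "\<lambda>w. a *\<^sub>R X w"]) (simp add: scaleR_fun_def)
    qed
  next
    fix \<xi> assume "\<xi> \<in> {X z | X W. smooth_local_section P D W X \<and> z \<in> W}"
    then obtain X W where X: "\<xi> = X z" "smooth_local_section P D W X" "z \<in> W" by blast
    define X' where "X' = (\<lambda>u. X (inv_into (fst d) (snd d) u) d)"
    have "smooth_on (model P) (snd d ` (fst d \<inter> W)) X'"
      using X(2) dP(1) by (simp add: smooth_local_section_def X'_def)
    then have C1: "Ck_on (Suc 0) (model P) (snd d ` (fst d \<inter> W)) X'" unfolding smooth_on_def by blast
    have op: "openin (top_of_set (model P)) (snd d ` (fst d \<inter> W))"
      using is_chart_image_open[OF ch] X(2) by (simp add: smooth_local_section_def)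
    have mem: "snd d z \<in> snd d ` (fst d \<inter> W)" using X(3) dP by blast
    have X'D: "X' w \<in> coord_distribution D d w \<and> w \<in> snd d ` fst d" if w: "w \<in> snd d ` (fst d \<inter> W)" for w
    proof -
      obtain y where y: "y \<in> fst d" "y \<in> W" "w = snd d y" using w by blast
      then have "X y \<in> D y" using X(2) by (simp add: smooth_local_section_def)
      then show ?thesis using y inj by (simp add: X'_def coord_distribution_def)
    qed
    from eventually_lipschitz_C1[OF V op mem C1] eventually_cball_Int_subset[OF op mem]
    have "\<forall>\<^sub>F R in at_right 0. (\<exists>C. C-lipschitz_on (cball (snd d z) R \<inter> model P) X') \<and>
            (\<forall>w\<in>cball (snd d z) R \<inter> model P. w \<in> snd d ` fst d \<and> X' w \<in> coord_distribution D d w)"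
      by eventually_elim (use X'D in blast)
    moreover have "X' (snd d z) = \<xi> d" using X(1) dP inj by (simp add: X'_def)
    ultimately show "?P \<xi>" by blast
  qed
qed

lemma leaf_obtain:
  assumes "integrable_distribution P D" "x \<in> points P"
  obtains N where "connected_integral_manifold P D N" "points N \<in> leaves P D" "x \<in> points N"
proof -
  obtain L where L: "L \<in> leaves P D" "x \<in> L"
    using assms unfolding integrable_distribution_def partition_on_def by blast
  then obtain N where "L = points N" "connected_integral_manifold P D N" unfolding leaves_def by blast
  then show ?thesis using that L by blast
qed

lemma equiv_leaf_rel:
  assumes "integrable_distribution P D"
  shows "equiv (points P) (leaf_rel P D)"
  using equiv_partition_on[OF assms[unfolded integrable_distribution_def]] by (simp add: leaf_rel_def)

lemma immersion_coordinates:
  fixes P N :: "('a, 'e::euclidean_space) manifold"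
  assumes P: "smooth_manifold P" and D: "smooth_distribution P D"
    and N: "connected_integral_manifold P D N"
    and c: "c \<in> atlas N" and d: "d \<in> atlas P" and u: "u \<in> coord_dom id c d"
  shows "coord_distribution D d (coord_rep id c d u)
       = frechet_derivative (coord_rep id c d) (at u within coord_dom id c d) ` model N"
    and "inj_on (frechet_derivative (coord_rep id c d) (at u within coord_dom id c d)) (model N)"
proof -
  obtain x where x: "x \<in> fst c" "x \<in> fst d" "u = snd c x" using u by (auto simp: coord_dom_id)
  have "immersed_submanifold P N" using N by (simp add: connected_integral_manifold_def)
  then have N': "smooth_manifold N" using immersed_submanifoldD P by blast
  have cd: "c \<in> charts_at N x" "d \<in> charts_at P x" using c d x by (auto simp: charts_at_def)
  note inj = is_chart_inj_on[OF smooth_manifoldD(2)[OF N' c]] is_chart_inj_on[OF smooth_manifoldD(2)[OF P d]]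
  from integral_manifold_tangent[OF P D N cd] show
    "coord_distribution D d (coord_rep id c d u)
       = frechet_derivative (coord_rep id c d) (at u within coord_dom id c d) ` model N"
    "inj_on (frechet_derivative (coord_rep id c d) (at u within coord_dom id c d)) (model N)"
    using x inj by (simp_all add: coord_rep_id coord_distribution_at coord_deriv_def)
qed

text \<open>For times near \<open>s0\<close> the curve lifts to a chart of the leaf through its
  position at \<open>s0\<close>, hence stays in that leaf. Lying in the same leaf is thus an
  equivalence relation that holds locally along the curve, and \<open>{0..1}\<close> is
  connected.\<close>

lemma integral_curve_in_leaf:
  fixes P :: "('a, 'e::euclidean_space) manifold" and X :: "'b \<Rightarrow> 'e \<Rightarrow> 'e"
  assumes P: "smooth_manifold P" and D: "smooth_distribution P D" and int: "integrable_distribution P D"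
    and d: "d \<in> atlas P"
    and B: "finite B" and X: "\<And>b. b \<in> B \<Longrightarrow> \<exists>C. C-lipschitz_on (ball z R \<inter> model P) (X b)"
    and XD: "\<And>b w. b \<in> B \<Longrightarrow> w \<in> ball z R \<inter> model P \<Longrightarrow> w \<in> snd d ` fst d \<and> X b w \<in> coord_distribution D d w"
    and sub: "ball z R \<inter> model P \<subseteq> snd d ` fst d"
    and t: "\<And>b. b \<in> B \<Longrightarrow> continuous_on {0..1} (t b)"
    and c: "\<And>s. s \<in> {0..1} \<Longrightarrow> c s \<in> ball z R \<inter> model P \<and>
            (c has_vector_derivative (\<Sum>b\<in>B. t b s *\<^sub>R X b (c s))) (at s within {0..1})"
  shows "(inv_into (fst d) (snd d) (c 0), inv_into (fst d) (snd d) (c 1)) \<in> leaf_rel P D"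
proof -
  define \<psi> where "\<psi> = inv_into (fst d) (snd d)"
  note ch = smooth_manifoldD(2)[OF P d]
  note inj = is_chart_inj_on[OF ch]
  have cimg: "c s \<in> snd d ` fst d" if "s \<in> {0..1}" for s using c[OF that] sub by blast
  then have \<psi>: "\<psi> (c s) \<in> fst d" "snd d (\<psi> (c s)) = c s" if "s \<in> {0..1}" for s
    using that by (auto simp: \<psi>_def inv_into_into f_inv_into_f)
  have \<psi>P: "\<psi> (c s) \<in> points P" if "s \<in> {0..1}" for s
    using \<psi>(1)[OF that] ch openin_subset by (auto simp: is_chart_def)
  note eq = equiv_leaf_rel[OF int]
  have "(\<psi> (c 0), \<psi> (c 1)) \<in> leaf_rel P D"
  proof (rule connected_equivalence_relation[where S = "{0..1::real}" and R = "\<lambda>s s'. (\<psi> (c s), \<psi> (c s')) \<in> leaf_rel P D"])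
    fix s0 :: real assume s0: "s0 \<in> {0..1}"
    obtain N where N: "connected_integral_manifold P D N" "points N \<in> leaves P D" "\<psi> (c s0) \<in> points N"
      using leaf_obtain[OF int \<psi>P[OF s0]] by blast
    have NP: "immersed_submanifold P N" using N by (simp add: connected_integral_manifold_def)
    note N' = immersed_submanifoldD[OF P NP]
    obtain k where k: "k \<in> atlas N" "\<psi> (c s0) \<in> fst k"
      using smooth_manifoldD(3)[OF N'(1) N(3)] by (auto simp: charts_at_def)
    note chk = smooth_manifoldD(2)[OF N'(1) k(1)]
    note injk = is_chart_inj_on[OF chk]
    let ?F = "coord_rep id k d" and ?S = "coord_dom id k d"
    have u0: "snd k (\<psi> (c s0)) \<in> ?S" using k \<psi>[OF s0] by (auto simp: coord_dom_id)
    have "\<exists>e>0. \<forall>s\<in>{0..1}. \<bar>s - s0\<bar> < e \<longrightarrow> c s \<in> ?F ` ?S"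
    proof (rule integral_curve_lifts[OF smooth_manifoldD(1)[OF N'(1)] N'(5)[OF k(1) d] u0 N'(6)[OF k(1) d] N'(7)[OF k(1) d]
          immersion_coordinates(2)[OF P D N(1) k(1) d u0] B X _ t c s0])
      fix b u assume b: "b \<in> B" and u: "u \<in> ?S" "?F u \<in> ball z R"
      have "?F u \<in> ball z R \<inter> model P" using u N'(7)[OF k(1) d] by blast
      then show "X b (?F u) \<in> frechet_derivative ?F (at u within ?S) ` model N"
        using XD[OF b] immersion_coordinates(1)[OF P D N(1) k(1) d u(1)] by blast
    next
      show "c s0 = ?F (snd k (\<psi> (c s0)))" using k \<psi>[OF s0] injk by (simp add: coord_rep_id)
    qed
    then obtain e where e: "e > 0" "\<And>s. s \<in> {0..1} \<Longrightarrow> \<bar>s - s0\<bar> < e \<Longrightarrow> c s \<in> ?F ` ?S" by blast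
    have "(\<psi> (c s0), \<psi> (c s)) \<in> leaf_rel P D" if "s \<in> {0..1} \<inter> ball s0 e" for s
    proof -
      have "c s \<in> snd d ` (fst k \<inter> fst d)"
        using e(2)[of s] that coord_rep_id_image[OF injk, of d] by (auto simp: dist_real_def abs_minus_commute)
      then have "\<psi> (c s) \<in> fst k" using inj by (auto simp: \<psi>_def)
      then have "\<psi> (c s) \<in> points N" using chk openin_subset by (auto simp: is_chart_def)
      then show ?thesis using N by (auto simp: leaf_rel_def)
    qed
    then show "\<exists>T. openin (top_of_set {0..1}) T \<and> s0 \<in> T \<and> (\<forall>x\<in>T. (\<psi> (c s0), \<psi> (c x)) \<in> leaf_rel P D)"
      using s0 e(1) by (intro exI[of _ "{0..1} \<inter> ball s0 e"]) auto
  qed (use eq in \<open>auto simp: equiv_def dest: symD transD\<close>)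
  then show ?thesis by (simp add: \<psi>_def)
qed

section \<open>Saturations of open sets\<close>

definition leaf_saturation ::
  "('a, 'e::euclidean_space) manifold \<Rightarrow> ('a, 'e) distribution \<Rightarrow> 'a set \<Rightarrow> 'a set" where
  "leaf_saturation P D U = leaf_rel P D `` U"

lemma leaf_rel_trans: "integrable_distribution P D \<Longrightarrow> trans (leaf_rel P D)"
  using equiv_leaf_rel by (auto simp: equiv_def)

lemma leaf_saturation_idem_subset:
  assumes "integrable_distribution P D" "A \<subseteq> leaf_saturation P D U"
  shows "leaf_saturation P D A \<subseteq> leaf_saturation P D U"
  using assms(2) leaf_rel_trans[OF assms(1)] unfolding leaf_saturation_def trans_def by blast

text \<open>Curves that accompany the segment from \<open>z\<close> to \<open>a\<close> carry the
  points of \<open>P\<close> near \<open>z\<close> into \<open>U\<close>, each within its own leaf.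
  That \<open>O1\<close> is chosen before \<open>a\<close> and \<open>U\<close> is essential: it
  turns one point \<open>z\<close> of a leaf that is not interior to a saturated set into a whole
  leaf neighbourhood of such points.\<close>

lemma local_leaf_transitivity:
  fixes P N :: "('a, 'e::euclidean_space) manifold"
  assumes P: "smooth_manifold P" and D: "smooth_distribution P D" and int: "integrable_distribution P D"
    and N: "connected_integral_manifold P D N" and z: "z \<in> points N"
  shows "\<exists>O1. openin (mtop N) O1 \<and> z \<in> O1 \<and>
    (\<forall>a\<in>O1. \<forall>U. openin (mtop P) U \<and> a \<in> U \<longrightarrow>
       (\<exists>C. openin (mtop P) C \<and> z \<in> C \<and> C \<subseteq> leaf_saturation P D U))"
proof -
  have NP: "immersed_submanifold P N" using N by (simp add: connected_integral_manifold_def)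
  note N' = immersed_submanifoldD[OF P NP]
  obtain c where c: "c \<in> charts_at N z" using smooth_manifoldD(3)[OF N'(1) z] by blast
  have "z \<in> points P" using z N'(2) by blast
  then obtain d where d: "d \<in> charts_at P z" using smooth_manifoldD(3)[OF P] by blast
  have cN: "c \<in> atlas N" "z \<in> fst c" and dP: "d \<in> atlas P" "z \<in> fst d"
    using c d by (auto simp: charts_at_def)
  have V: "subspace (model N)" and W: "subspace (model P)"
    using smooth_manifoldD(1) N'(1) P by blast+
  note chc = smooth_manifoldD(2)[OF N'(1) cN(1)] and chd = smooth_manifoldD(2)[OF P dP(1)]
  note injc = is_chart_inj_on[OF chc] and injd = is_chart_inj_on[OF chd]
  define F where "F = coord_rep id c d"
  define S where "S = coord_dom id c d"
  define u0 where "u0 = snd c z"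
  have u0: "u0 \<in> S" using cN dP by (auto simp: S_def u0_def coord_dom_id)
  have S: "openin (top_of_set (model N)) S" and F: "smooth_on (model N) S F" and FW: "F ` S \<subseteq> model P"
    unfolding S_def F_def by (rule N'(5-7)[OF cN(1) dP(1)])+
  have Fc: "F (snd c x) = snd d x" if "x \<in> fst c" for x
    using that injc by (simp add: F_def coord_rep_id)
  have Fu0: "F u0 = snd d z" using Fc cN by (simp add: u0_def)
  note im = immersion_coordinates[OF P D N cN(1) dP(1), folded S_def F_def]
  obtain B where B: "finite B" "B \<subseteq> model N" "\<And>b. b \<in> B \<Longrightarrow> norm b = 1"
    "\<And>x. x \<in> model N \<Longrightarrow> (\<Sum>b\<in>B. (x \<bullet> b) *\<^sub>R b) = x"
    using subspace_orthonormal_basis[OF V] by metis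
  \<comment> \<open>Each basis vector of the model space of the leaf is pushed forward to
    \<open>D z\<close> and then extended to a Lipschitz field tangent to \<open>D\<close> on a ball
    in the chart of \<open>P\<close>.\<close>
  have "\<exists>X. X (F u0) = frechet_derivative F (at u0 within S) b \<and>
      (\<forall>\<^sub>F R in at_right 0. (\<exists>C. C-lipschitz_on (cball (F u0) R \<inter> model P) X) \<and>
            (\<forall>w\<in>cball (F u0) R \<inter> model P. w \<in> snd d ` fst d \<and> X w \<in> coord_distribution D d w))"
    if "b \<in> B" for b
  proof -
    have "frechet_derivative F (at u0 within S) b \<in> coord_distribution D d (snd d z)"
      using im(1)[OF u0] B(2) that Fu0 by auto
    then obtain \<xi> where "\<xi> \<in> D z" "frechet_derivative F (at u0 within S) b = \<xi> d"
      using coord_distribution_at[OF injd dP(2)] by auto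
    then show ?thesis using local_lipschitz_field[OF P D d] Fu0 by simp
  qed
  then have "\<forall>b\<in>B. \<exists>X. X (F u0) = frechet_derivative F (at u0 within S) b \<and>
      (\<forall>\<^sub>F R in at_right 0. (\<exists>C. C-lipschitz_on (cball (F u0) R \<inter> model P) X) \<and>
            (\<forall>w\<in>cball (F u0) R \<inter> model P. w \<in> snd d ` fst d \<and> X w \<in> coord_distribution D d w))"
    by blast
  from bchoice[OF this] obtain X where X0: "\<And>b. b \<in> B \<Longrightarrow> X b (F u0) = frechet_derivative F (at u0 within S) b"
    and X: "\<And>b. b \<in> B \<Longrightarrow> \<forall>\<^sub>F R in at_right 0. (\<exists>C. C-lipschitz_on (cball (F u0) R \<inter> model P) (X b)) \<and>
            (\<forall>w\<in>cball (F u0) R \<inter> model P. w \<in> snd d ` fst d \<and> X b w \<in> coord_distribution D d w)"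
    by blast
  have "openin (top_of_set (model P)) (snd d ` fst d)" using chd by (simp add: is_chart_def)
  then have "\<forall>\<^sub>F R in at_right 0. cball (F u0) R \<inter> model P \<subseteq> snd d ` fst d"
    by (rule eventually_cball_Int_subset) (use Fu0 dP in auto)
  moreover have "\<forall>\<^sub>F R in at_right 0. \<forall>b\<in>B. (\<exists>C. C-lipschitz_on (cball (F u0) R \<inter> model P) (X b)) \<and>
            (\<forall>w\<in>cball (F u0) R \<inter> model P. w \<in> snd d ` fst d \<and> X b w \<in> coord_distribution D d w)"
    using X B(1) by (simp add: eventually_ball_finite)
  ultimately have "\<forall>\<^sub>F R in at_right 0. 0 < R \<and> cball (F u0) R \<inter> model P \<subseteq> snd d ` fst d \<and>
       (\<forall>b\<in>B. (\<exists>C. C-lipschitz_on (cball (F u0) R \<inter> model P) (X b)) \<and>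
            (\<forall>w\<in>cball (F u0) R \<inter> model P. w \<in> snd d ` fst d \<and> X b w \<in> coord_distribution D d w))"
    using eventually_at_right_less[of 0] by eventually_elim blast
  from eventually_happens'[OF trivial_limit_at_right_real this]
  obtain R where R: "0 < R" "cball (F u0) R \<inter> model P \<subseteq> snd d ` fst d"
    and RX: "\<And>b. b \<in> B \<Longrightarrow> \<exists>C. C-lipschitz_on (cball (F u0) R \<inter> model P) (X b)"
    and RD: "\<And>b w. b \<in> B \<Longrightarrow> w \<in> cball (F u0) R \<inter> model P \<Longrightarrow> w \<in> snd d ` fst d \<and> X b w \<in> coord_distribution D d w"
    by blast
  have ball: "ball (F u0) R \<inter> model P \<subseteq> cball (F u0) R \<inter> model P" by auto
  have X1: "\<exists>C. C-lipschitz_on (ball (F u0) R \<inter> model P) (X b)" if "b \<in> B" for b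
    using RX[OF that] lipschitz_on_subset[OF _ ball] by blast
  have X2: "w \<in> snd d ` fst d \<and> X b w \<in> coord_distribution D d w" if "b \<in> B" "w \<in> ball (F u0) R \<inter> model P" for b w
    using RD[OF that(1)] that(2) ball by blast
  have X3: "X b w \<in> model P" if "b \<in> B" "w \<in> ball (F u0) R \<inter> model P" for b w
    using X2[OF that] coord_distribution_subspace(2)[OF P D dP(1)] by blast
  have X4: "X b (F u) \<in> frechet_derivative F (at u within S) ` model N"
    if "b \<in> B" "u \<in> S" "F u \<in> ball (F u0) R" for b u
    using X2[OF that(1), of "F u"] that FW im(1)[OF that(2)] by blast
  obtain r where r: "r > 0" and transport: "\<And>u1. u1 \<in> ball u0 r \<inter> model N \<Longrightarrow> u1 \<in> S \<and>
     (\<exists>t. (\<forall>b\<in>B. continuous_on {0..1} (t b)) \<and>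
     (\<exists>e>0. \<forall>w0\<in>model P. norm (w0 - F u0) \<le> e \<longrightarrow> (\<exists>c. c 0 = w0 \<and>
        (\<forall>s\<in>{0..1}. c s \<in> ball (F u0) R \<inter> model P \<and>
            (c has_vector_derivative (\<Sum>b\<in>B. t b s *\<^sub>R X b (c s))) (at s within {0..1})) \<and>
        norm (c 1 - F u1) \<le> 2 * norm (w0 - F u0))))"
    using leafwise_transport[OF V W S u0 F FW im(2)[OF u0] B R(1) X1 X3 X4 X0] by blast
  define O1 where "O1 = {x \<in> fst c. snd c x \<in> ball u0 r \<inter> model N}"
  have cV: "snd c x \<in> model N" if "x \<in> fst c" for x
    using chc openin_imp_subset that unfolding is_chart_def by blast
  have dV: "snd d x \<in> model P" if "x \<in> fst d" for x
    using chd openin_imp_subset that unfolding is_chart_def by blast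
  have "openin (mtop N) O1"
    unfolding O1_def by (rule is_chart_vimage_open[OF chc]) (simp add: openin_open_Int Int_commute)
  moreover have "z \<in> O1" using cN cV r by (simp add: O1_def u0_def)
  moreover have "\<exists>C. openin (mtop P) C \<and> z \<in> C \<and> C \<subseteq> leaf_saturation P D U"
    if a: "a \<in> O1" and U: "openin (mtop P) U" "a \<in> U" for a U
  proof -
    have ac: "a \<in> fst c" "snd c a \<in> ball u0 r \<inter> model N" using a by (auto simp: O1_def)
    have "snd c a \<in> S" using transport[OF ac(2)] by blast
    then have ad: "a \<in> fst d" using ac(1) injc by (auto simp: S_def coord_dom_id dest: inj_onD)
    obtain t e where t: "\<And>b. b \<in> B \<Longrightarrow> continuous_on {0..1} (t b)" and e: "e > 0"
      and curve: "\<And>w0. w0 \<in> model P \<Longrightarrow> norm (w0 - F u0) \<le> e \<Longrightarrow> \<exists>c. c 0 = w0 \<and>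
        (\<forall>s\<in>{0..1}. c s \<in> ball (F u0) R \<inter> model P \<and>
            (c has_vector_derivative (\<Sum>b\<in>B. t b s *\<^sub>R X b (c s))) (at s within {0..1})) \<and>
        norm (c 1 - snd d a) \<le> 2 * norm (w0 - F u0)"
      using transport[OF ac(2)] unfolding Fc[OF ac(1)] by blast
    have "snd d a \<in> snd d ` (fst d \<inter> U)" using ad U by blast
    then obtain \<epsilon> where \<epsilon>: "\<epsilon> > 0" "cball (snd d a) \<epsilon> \<inter> model P \<subseteq> snd d ` (fst d \<inter> U)"
      using is_chart_image_open[OF chd U(1)] unfolding openin_contains_cball by metis
    \<comment> \<open>\<open>e\<close> guarantees that the curve exists, and
      \<open>\<epsilon> / 2\<close> makes up for the factor 2 in the transport estimate.\<close>
    define m where "m = min e (\<epsilon> / 2)"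
    define C where "C = {y \<in> fst d. snd d y \<in> ball (F u0) m \<inter> model P}"
    have "openin (mtop P) C"
      unfolding C_def by (rule is_chart_vimage_open[OF chd]) (simp add: openin_open_Int Int_commute)
    moreover have "z \<in> C" using dP dV e \<epsilon> by (simp add: C_def Fu0 m_def)
    moreover have "y \<in> leaf_saturation P D U" if y: "y \<in> C" for y
    proof -
      have yd: "y \<in> fst d" "snd d y \<in> model P" "norm (snd d y - F u0) \<le> e" "2 * norm (snd d y - F u0) \<le> \<epsilon>"
        using y by (auto simp: C_def m_def dist_norm norm_minus_commute)
      obtain k where k0: "k 0 = snd d y" and k: "\<And>s. s \<in> {0..1} \<Longrightarrow> k s \<in> ball (F u0) R \<inter> model P \<and>
            (k has_vector_derivative (\<Sum>b\<in>B. t b s *\<^sub>R X b (k s))) (at s within {0..1})"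
        and k1: "norm (k 1 - snd d a) \<le> 2 * norm (snd d y - F u0)"
        using curve[OF yd(2,3)] by blast
      have sub: "ball (F u0) R \<inter> model P \<subseteq> snd d ` fst d" using R(2) by auto
      have "(inv_into (fst d) (snd d) (k 0), inv_into (fst d) (snd d) (k 1)) \<in> leaf_rel P D"
        by (rule integral_curve_in_leaf[OF P D int dP(1) B(1) X1 X2 sub t k])
      \<comment> \<open>The curve runs from \<open>y\<close> towards \<open>a\<close>, whereas the
        saturation is formed from \<open>U\<close>, so the relation is reversed here.\<close>
      then have rel: "(inv_into (fst d) (snd d) (k 1), y) \<in> leaf_rel P D"
        using k0 yd(1) injd by (auto simp: leaf_rel_def)
      have "k 1 \<in> cball (snd d a) \<epsilon> \<inter> model P"
        using k[of 1] k1 yd(4) by (simp add: dist_norm norm_minus_commute)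
      then have "k 1 \<in> snd d ` (fst d \<inter> U)" using \<epsilon>(2) by blast
      then have "inv_into (fst d) (snd d) (k 1) \<in> U" using injd by auto
      with rel show ?thesis by (auto simp: leaf_saturation_def)
    qed
    ultimately show ?thesis by blast
  qed
  ultimately show ?thesis by blast
qed

lemma openin_leaf_saturation:
  fixes P :: "('a, 'e::euclidean_space) manifold"
  assumes P: "smooth_manifold P" and D: "smooth_distribution P D" and int: "integrable_distribution P D"
    and U: "openin (mtop P) U"
  shows "openin (mtop P) (leaf_saturation P D U)"
proof -
  let ?X = "mtop P" and ?S = "leaf_saturation P D U"
  note eq = equiv_leaf_rel[OF int]
  have Usub: "U \<subseteq> ?S"
    using openin_subset[OF U] equiv_class_self[OF eq] unfolding leaf_saturation_def by blast
  have "y \<in> ?X interior_of ?S" if y: "y \<in> ?S" for y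
  proof -
    obtain x L where xL: "x \<in> U" "L \<in> leaves P D" "x \<in> L" "y \<in> L"
      using y by (auto simp: leaf_saturation_def leaf_rel_def)
    then obtain N where N: "connected_integral_manifold P D N" and L: "L = points N"
      unfolding leaves_def by blast
    have NP: "immersed_submanifold P N" using N by (simp add: connected_integral_manifold_def)
    note N' = immersed_submanifoldD[OF P NP]
    define A where "A = points N \<inter> ?X interior_of ?S"
    \<comment> \<open>Continuity of the inclusion makes \<open>A\<close> open in the finer topology
      of the leaf.\<close>
    have A: "openin (mtop N) A" unfolding A_def by (rule N'(3)) simp
    have "openin (mtop N) (points N - A)"
    proof (rule openin_subopen[THEN iffD2], intro ballI)
      fix z assume z: "z \<in> points N - A"
      then have "z \<in> points N" by blast
      from local_leaf_transitivity[OF P D int N this] obtain O1 where O1: "openin (mtop N) O1" "z \<in> O1"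
        and tr: "\<And>a V. a \<in> O1 \<Longrightarrow> openin ?X V \<Longrightarrow> a \<in> V \<Longrightarrow>
             \<exists>C. openin ?X C \<and> z \<in> C \<and> C \<subseteq> leaf_saturation P D V"
        by (elim exE conjE) (rule that, blast+)
      have "a \<notin> A" if a: "a \<in> O1" for a
      proof
        assume "a \<in> A"
        then have "a \<in> ?X interior_of ?S" by (simp add: A_def)
        \<comment> \<open>The transport is applied to the interior of \<open>?S\<close> itself. Its
          saturation stays inside \<open>?S\<close>, so \<open>C\<close> makes \<open>z\<close> an
          interior point, contrary to the choice of \<open>z\<close>.\<close>
        then obtain C where C: "openin ?X C" "z \<in> C" "C \<subseteq> leaf_saturation P D (?X interior_of ?S)"
          using tr[OF a, of "?X interior_of ?S"] by auto
        have "C \<subseteq> ?S"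
          by (rule order_trans[OF C(3) leaf_saturation_idem_subset[OF int interior_of_subset]])
        then have "z \<in> ?X interior_of ?S" using C(1,2) interior_of_maximal[of C ?S ?X] by blast
        then show False using z by (simp add: A_def)
      qed
      then have "O1 \<subseteq> points N - A" using openin_subset[OF O1(1)] by blast
      with O1 show "\<exists>T. openin (mtop N) T \<and> z \<in> T \<and> T \<subseteq> points N - A" by blast
    qed
    then have "closedin (mtop N) A" using openin_subset[OF A] by (simp add: closedin_def)
    moreover have "connected_space (mtop N)" using N by (simp add: connected_integral_manifold_def)
    moreover have "x \<in> A" using xL L interior_of_maximal[OF Usub U] unfolding A_def by blast
    ultimately have "A = points N" using A unfolding connected_space_clopen_in by blast
    then show ?thesis using xL L by (auto simp: A_def)
  qed
  then have "?S \<subseteq> ?X interior_of ?S" by (rule subsetI)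
  then have "?X interior_of ?S = ?S" by (rule subset_antisym[OF interior_of_subset])
  then show ?thesis by (simp only: interior_of_eq)
qed

lemma leaf_proj_quotient_map: "quotient_map (mtop P) (leaf_space P D) (leaf_proj P D)"
  unfolding leaf_space_def leaf_proj_def by (rule quotient_map_proj)

lemma open_map_leaf_proj:
  fixes P :: "('a, 'e::euclidean_space) manifold"
  assumes P: "smooth_manifold P" and D: "smooth_distribution P D" and int: "integrable_distribution P D"
  shows "open_map (mtop P) (leaf_space P D) (leaf_proj P D)"
  unfolding open_map_def
proof (intro allI impI)
  fix U assume U: "openin (mtop P) U"
  note eq = equiv_leaf_rel[OF int]
  have Usub: "U \<subseteq> points P" using openin_subset[OF U] .
  \<comment> \<open>Openness in the quotient is tested on preimages, and the preimage of an image is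
    a saturation.\<close>
  have "{x \<in> points P. leaf_proj P D x \<in> leaf_proj P D ` U} = leaf_saturation P D U"
  proof (intro equalityI subsetI)
    fix x assume "x \<in> {x \<in> points P. leaf_proj P D x \<in> leaf_proj P D ` U}"
    then obtain u where "x \<in> points P" "u \<in> U" "leaf_rel P D `` {u} = leaf_rel P D `` {x}"
      by (auto simp: leaf_proj_def Equiv_Relations.proj_def)
    then show "x \<in> leaf_saturation P D U"
      using equiv_class_self[OF eq, of x] unfolding leaf_saturation_def by blast
  next
    fix x assume "x \<in> leaf_saturation P D U"
    then obtain u where u: "u \<in> U" "(u, x) \<in> leaf_rel P D" by (auto simp: leaf_saturation_def)
    then have "x \<in> points P" "leaf_proj P D u = leaf_proj P D x"
      using eq equiv_class_eq[OF eq u(2)] by (auto simp: leaf_proj_def Equiv_Relations.proj_def equiv_def refl_on_def)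
    then show "x \<in> {x \<in> points P. leaf_proj P D x \<in> leaf_proj P D ` U}" using u(1) by (metis (mono_tags, lifting) image_eqI mem_Collect_eq)
  qed
  then have op: "openin (mtop P) {x \<in> points P. leaf_proj P D x \<in> leaf_proj P D ` U}"
    using openin_leaf_saturation[OF P D int U] by simp
  have "leaf_proj P D ` U \<subseteq> topspace (leaf_space P D)"
    unfolding quotient_imp_surjective_map[OF leaf_proj_quotient_map, symmetric] using Usub by (rule image_mono)
  from leaf_proj_quotient_map[unfolded quotient_map_def, THEN conjunct2, rule_format, OF this] op
  show "openin (leaf_space P D) (leaf_proj P D ` U)" by (rule iffD1)
qed

subsection \<open>The quotient of the leaf space\<close>

lemma T2_sym: "\<lbrakk>x \<in> topspace X; y \<in> T2 X x\<rbrakk> \<Longrightarrow> x \<in> T2 X y"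
  unfolding T2_def by blast

lemma T2_refl: "x \<in> topspace X \<Longrightarrow> x \<in> T2 X x"
  unfolding T2_def by blast

lemma T2_subset: "T2 X x \<subseteq> topspace X"
  unfolding T2_def by blast

lemma proj_T2_rel: "x \<in> topspace X \<Longrightarrow> proj (T2_rel X) x = T2 X x"
  by (auto simp: Equiv_Relations.proj_def T2_rel_def)

text \<open>By idempotence, distinct classes have representatives \<open>x\<close> and
  \<open>y\<close> with disjoint open neighbourhoods \<open>U\<close> and \<open>V\<close>. Their
  images are disjoint too: a common class of \<open>u\<close> and \<open>v\<close> would put
  \<open>v\<close> into \<open>T2 X u\<close>, yet the same \<open>U\<close> and \<open>V\<close>
  separate \<open>u\<close> from \<open>v\<close>. Openness of the projection makes the images
  open.\<close>

lemma Hausdorff_space_T2_quotient: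
  assumes idem: "\<And>x y. x \<in> topspace X \<Longrightarrow> y \<in> T2 X x \<Longrightarrow> T2 X y = T2 X x"
    and op: "open_map X (quotient_topology X (T2_rel X)) (proj (T2_rel X))"
  shows "Hausdorff_space (quotient_topology X (T2_rel X))"
  unfolding Hausdorff_space_def
proof (intro allI impI, elim conjE)
  let ?p = "proj (T2_rel X)"
  have surj: "?p ` topspace X = topspace (quotient_topology X (T2_rel X))"
    by (rule quotient_imp_surjective_map[OF quotient_map_proj])
  fix p q assume "p \<in> topspace (quotient_topology X (T2_rel X))" "q \<in> topspace (quotient_topology X (T2_rel X))"
    and ne: "p \<noteq> q"
  then obtain x y where xy: "x \<in> topspace X" "y \<in> topspace X" "p = ?p x" "q = ?p y"
    using surj by (metis imageE)
  then have "y \<notin> T2 X x" using ne idem[OF xy(1)] by (auto simp: proj_T2_rel)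
  then obtain U V where UV: "openin X U" "x \<in> U" "openin X V" "y \<in> V" "U \<inter> V = {}"
    using xy(2) unfolding T2_def by blast
  have "disjnt (?p ` U) (?p ` V)"
    unfolding disjnt_def
  proof (rule equals0I)
    fix r assume "r \<in> ?p ` U \<inter> ?p ` V"
    then obtain u v where uv: "u \<in> U" "v \<in> V" "?p u = ?p v" by auto
    then have X: "u \<in> topspace X" "v \<in> topspace X" using UV openin_subset by blast+
    then have "v \<in> T2 X u" using uv(3) T2_refl[OF X(2)] by (simp add: proj_T2_rel)
    then show False using UV uv unfolding T2_def by blast
  qed
  moreover have "openin (quotient_topology X (T2_rel X)) (?p ` U)" "openin (quotient_topology X (T2_rel X)) (?p ` V)"
    using op UV unfolding open_map_def by blast+
  ultimately show "\<exists>U V. openin (quotient_topology X (T2_rel X)) U \<and> openin (quotient_topology X (T2_rel X)) V \<and> p \<in> U \<and> q \<in> V \<and> disjnt U V"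
    using xy UV by blast
qed

section \<open>Real functions and local compactness\<close>

lemma Tychonoff_separation:
  assumes "completely_regular_space Y" "Hausdorff_space Y" "p \<in> topspace Y" "q \<in> topspace Y" "p \<noteq> q"
  shows "\<exists>g. continuous_map Y euclideanreal g \<and> g p \<noteq> g q"
proof -
  have "closedin Y {q}" using assms(4) closedin_Hausdorff_sing_eq[OF assms(2)] by simp
  with assms(3,5) have "closedin Y {q} \<and> p \<in> topspace Y - {q}" by blast
  from assms(1)[unfolded completely_regular_space_def, rule_format, OF this]
  obtain f where f: "continuous_map Y (top_of_set {0..1}) f" "f p = (0::real)" "f ` {q} \<subseteq> {1}"
    by blast
  then have "continuous_map Y euclideanreal f" by (simp add: continuous_map_in_subtopology)
  with f show ?thesis by (intro exI[of _ f]) auto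
qed

text \<open>The model space is a closed subspace, so its intersection with a small closed ball is a
  compact subset of the image of a chart, and the inverse of the chart carries it to a compact
  neighbourhood.\<close>

lemma locally_compact_manifold:
  fixes M :: "('a, 'e::euclidean_space) manifold"
  assumes M: "smooth_manifold M"
  shows "locally_compact_space (mtop M)"
  unfolding locally_compact_space_def
proof (intro ballI)
  fix x assume "x \<in> points M"
  then obtain c where c: "c \<in> charts_at M x" using smooth_manifoldD(3)[OF M] by blast
  then have x: "x \<in> fst c" and ch: "is_chart (mtop M) (model M) c"
    using smooth_manifoldD(2)[OF M] by (auto simp: charts_at_def)
  define I where "I = snd c ` fst c"
  have I: "openin (top_of_set (model M)) I" "snd c x \<in> I" using ch x by (auto simp: I_def is_chart_def)
  obtain r where r: "r > 0" "cball (snd c x) r \<inter> model M \<subseteq> I"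
    using I unfolding openin_contains_cball by metis
  have "homeomorphic_map (subtopology (mtop M) (fst c)) (top_of_set I) (snd c)"
    using ch by (simp add: is_chart_def I_def)
  then obtain g where g: "homeomorphic_maps (subtopology (mtop M) (fst c)) (top_of_set I) (snd c) g"
    unfolding homeomorphic_map_maps by (elim exE)
  have sub: "fst c \<subseteq> points M" using ch openin_subset unfolding is_chart_def by blast
  define K where "K = g ` (cball (snd c x) r \<inter> model M)"
  define U where "U = {y \<in> fst c. snd c y \<in> ball (snd c x) r \<inter> model M}"
  have "compactin (top_of_set I) (cball (snd c x) r \<inter> model M)"
    using r(2) smooth_manifoldD(1)[OF M]
    by (simp add: compactin_subtopology compact_Int_closed closed_subspace)
  moreover have "continuous_map (top_of_set I) (subtopology (mtop M) (fst c)) g"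
    using g by (simp add: homeomorphic_maps_def)
  ultimately have "compactin (subtopology (mtop M) (fst c)) K"
    unfolding K_def by (rule image_compactin)
  then have "compactin (mtop M) K" by (simp add: compactin_subtopology)
  moreover have "openin (mtop M) U"
    unfolding U_def by (rule is_chart_vimage_open[OF ch]) (simp add: openin_open_Int Int_commute)
  moreover have "x \<in> U" using x r(1) I openin_imp_subset by (fastforce simp: U_def)
  moreover have "U \<subseteq> K"
  proof
    fix y assume y: "y \<in> U"
    then have "g (snd c y) = y" using g sub by (auto simp: homeomorphic_maps_def U_def)
    moreover have "snd c y \<in> cball (snd c x) r \<inter> model M" using y by (auto simp: U_def)
    ultimately show "y \<in> K" unfolding K_def by (metis imageI)
  qed
  ultimately show "\<exists>U K. openin (mtop M) U \<and> compactin (mtop M) K \<and> x \<in> U \<and> U \<subseteq> K" by blast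
qed

theorem theorem4p8:
  fixes P :: "('a, 'e::euclidean_space) manifold" and D :: "('a, 'e) distribution"
  assumes "smooth_manifold P"
    and "Hausdorff_space (mtop P)"
    and "paracompact_space (mtop P)"
    and "smooth_distribution P D"
    and "integrable_distribution P D"
    and "T2bar_idempotent P D"
    and "open_map (leaf_space P D)
           (quotient_topology (leaf_space P D) (T2_rel (leaf_space P D)))
           (proj (T2_rel (leaf_space P D)))"
  shows "open_map (mtop P) (quotient_topology (mtop P) (T2bar_rel P D)) (proj (T2bar_rel P D)) \<and>
    (\<forall>x\<in>points P. \<forall>y\<in>points P. T2bar P D x \<noteq> T2bar P D y \<longrightarrow>
       (\<exists>f. continuous_first_integral P D f \<and> f x \<noteq> f y)) \<and>
    (\<forall>z\<in>points P. \<exists>\<C>. (\<forall>C\<in>\<C>. continuous_first_integral P D C) \<and>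
       T2bar P D z = (\<Inter>C\<in>\<C>. C -` {C z}) \<inter> points P)"
proof -
  let ?X = "mtop P" and ?Y = "leaf_space P D"
  let ?\<pi> = "leaf_proj P D"
  let ?Q = "quotient_topology ?Y (T2_rel ?Y)" and ?p = "proj (T2_rel ?Y)"
  \<comment> \<open>The fibres of this composite projection turn out to be the \<open>T2bar\<close>
    sets, so the separation problem moves to \<open>?Q\<close>.\<close>
  define f where "f = ?p \<circ> ?\<pi>"
  have \<pi>surj: "?\<pi> ` points P = topspace ?Y"
    by (rule quotient_imp_surjective_map[OF leaf_proj_quotient_map])
  then have \<pi>: "?\<pi> x \<in> topspace ?Y" if "x \<in> points P" for x using that by blast
  have \<pi>cont: "continuous_map ?X ?Y ?\<pi>"
    by (rule quotient_imp_continuous_map[OF leaf_proj_quotient_map])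
  have \<pi>open: "open_map ?X ?Y ?\<pi>" by (rule open_map_leaf_proj[OF assms(1,4,5)])
  have f: "f x = T2 ?Y (?\<pi> x)" if "x \<in> points P" for x
    using \<pi>[OF that] by (simp add: f_def proj_T2_rel)
  have fsurj: "f ` points P = topspace ?Q"
    using quotient_imp_surjective_map[OF quotient_map_proj, of "T2_rel ?Y" ?Y] \<pi>surj
    by (simp only: f_def image_comp[symmetric])
  have fcont: "continuous_map ?X ?Q f"
    unfolding f_def by (rule continuous_map_compose[OF \<pi>cont quotient_imp_continuous_map[OF quotient_map_proj]])
  have fopen: "open_map ?X ?Q f"
    unfolding f_def by (rule open_map_compose[OF \<pi>open assms(7)])
  have T2bar: "T2bar P D x = {y \<in> points P. ?\<pi> y \<in> T2 ?Y (?\<pi> x)}" for x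
    by (simp add: T2bar_def)
  \<comment> \<open>Idempotence is given for sets of points of \<open>P\<close>; lifting the three
    leaves to points transfers it to the leaf space. Symmetry of \<open>T2\<close> then turns the
    inclusion into an equality.\<close>
  have T2_mono: "T2 ?Y \<sigma> \<subseteq> T2 ?Y \<rho>" if \<rho>: "\<rho> \<in> topspace ?Y" and \<sigma>: "\<sigma> \<in> T2 ?Y \<rho>" for \<rho> \<sigma>
  proof
    fix \<tau> assume \<tau>: "\<tau> \<in> T2 ?Y \<sigma>"
    obtain x where x: "x \<in> points P" "\<rho> = ?\<pi> x" using \<rho> \<pi>surj by blast
    obtain y where y: "y \<in> points P" "\<sigma> = ?\<pi> y" using subsetD[OF T2_subset \<sigma>] \<pi>surj by blast
    obtain w where w: "w \<in> points P" "\<tau> = ?\<pi> w" using subsetD[OF T2_subset \<tau>] \<pi>surj by blast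
    have "y \<in> T2bar P D x" "w \<in> T2bar P D y" using x y w \<sigma> \<tau> by (simp_all add: T2bar)
    then have "w \<in> T2bar P D x" using assms(6) x(1) unfolding T2bar_idempotent_def by blast
    then show "\<tau> \<in> T2 ?Y \<rho>" using x w by (simp add: T2bar)
  qed
  have idem: "T2 ?Y \<sigma> = T2 ?Y \<rho>" if "\<rho> \<in> topspace ?Y" "\<sigma> \<in> T2 ?Y \<rho>" for \<rho> \<sigma>
  proof (rule subset_antisym)
    show "T2 ?Y \<sigma> \<subseteq> T2 ?Y \<rho>" by (rule T2_mono[OF that])
    show "T2 ?Y \<rho> \<subseteq> T2 ?Y \<sigma>"
      by (rule T2_mono[OF subsetD[OF T2_subset that(2)] T2_sym[OF that]])
  qed
  \<comment> \<open>A \<open>T2\<close> set is recovered from its preimage in \<open>P\<close>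
    because the leaf projection is surjective.\<close>
  have classes: "T2bar P D x = T2bar P D y \<longleftrightarrow> f x = f y" if "x \<in> points P" "y \<in> points P" for x y
  proof -
    have "?\<pi> ` {y \<in> points P. ?\<pi> y \<in> A} = A" if "A \<subseteq> topspace ?Y" for A
      using that unfolding \<pi>surj[symmetric] by auto
    then have "?\<pi> ` T2bar P D z = T2 ?Y (?\<pi> z)" for z
      unfolding T2bar by (simp add: T2_subset)
    then have "T2 ?Y (?\<pi> x) = T2 ?Y (?\<pi> y)" if "T2bar P D x = T2bar P D y" using that by metis
    then show ?thesis using that by (auto simp: f T2bar)
  qed
  have mem: "y \<in> T2bar P D z \<longleftrightarrow> f y = f z" if "y \<in> points P" "z \<in> points P" for y z
    using that idem[of "?\<pi> z" "?\<pi> y"] \<pi> T2_refl[of "?\<pi> y" ?Y] by (auto simp: f T2bar)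
  have H: "Hausdorff_space ?Q" by (rule Hausdorff_space_T2_quotient[OF idem assms(7)])
  have "locally_compact_space ?Q"
    by (rule locally_compact_space_continuous_open_map_image[OF fcont fopen fsurj locally_compact_manifold[OF assms(1)]])
  \<comment> \<open>A locally compact Hausdorff space is completely regular, which supplies the real
    functions on \<open>?Q\<close>.\<close>
  then have CR: "completely_regular_space ?Q"
    by (rule locally_compact_regular_imp_completely_regular_space) (use H in simp)
  have integral: "continuous_first_integral P D (g \<circ> f)" if g: "continuous_map ?Q euclideanreal g" for g
    unfolding continuous_first_integral_def
  proof (intro conjI ballI)
    show "continuous_map ?X euclideanreal (g \<circ> f)" by (rule continuous_map_compose[OF fcont g])
    fix L x y assume "L \<in> leaves P D" "x \<in> L" "y \<in> L"
    then have "(x, y) \<in> leaf_rel P D" by (auto simp: leaf_rel_def)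
    then have "?\<pi> x = ?\<pi> y"
      using equiv_class_eq[OF equiv_leaf_rel[OF assms(5)]] by (simp add: leaf_proj_def Equiv_Relations.proj_def)
    then show "(g \<circ> f) x = (g \<circ> f) y" by (simp add: f_def)
  qed
  have separation: "\<exists>g. continuous_map ?Q euclideanreal g \<and> g (f x) \<noteq> g (f y)"
    if "x \<in> points P" "y \<in> points P" "f x \<noteq> f y" for x y
    by (rule Tychonoff_separation[OF CR H _ _ that(3)]) (use that fsurj in blast)+
  have op: "open_map ?X (quotient_topology ?X (T2bar_rel P D)) (proj (T2bar_rel P D))"
    unfolding open_map_def
  proof (intro allI impI)
    fix U assume U: "openin ?X U"
    then have sub: "U \<subseteq> points P" by (rule openin_subset)
    have pr: "proj (T2bar_rel P D) x = T2bar P D x" if "x \<in> points P" for x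
      using that by (simp add: Equiv_Relations.proj_def T2bar_rel_def)
    \<comment> \<open>One quotient consists of sets of points and the other of sets of leaves. They
      are compared through preimages in \<open>P\<close>, which coincide because both projections
      have the same fibres.\<close>
    have "{x \<in> points P. proj (T2bar_rel P D) x \<in> proj (T2bar_rel P D) ` U} = {x \<in> points P. f x \<in> f ` U}"
    proof (intro Collect_cong conj_cong refl)
      fix x assume x: "x \<in> points P"
      have "proj (T2bar_rel P D) x = proj (T2bar_rel P D) u \<longleftrightarrow> f x = f u" if "u \<in> U" for u
        using pr[OF x] pr[OF subsetD[OF sub that]] classes[OF x subsetD[OF sub that]] by simp
      then show "proj (T2bar_rel P D) x \<in> proj (T2bar_rel P D) ` U \<longleftrightarrow> f x \<in> f ` U"
        by (simp add: image_iff)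
    qed
    moreover have "openin ?Q (f ` U)" using fopen U by (simp add: open_map_def)
    ultimately have "openin ?X {x \<in> points P. proj (T2bar_rel P D) x \<in> proj (T2bar_rel P D) ` U}"
      using openin_continuous_map_preimage[OF fcont] by simp
    then show "openin (quotient_topology ?X (T2bar_rel P D)) (proj (T2bar_rel P D) ` U)"
      using sub unfolding openin_quotient_topology Equiv_Relations.proj_def by (auto intro: quotientI)
  qed
  have sep: "\<exists>h. continuous_first_integral P D h \<and> h x \<noteq> h y"
    if xy: "x \<in> points P" "y \<in> points P" "T2bar P D x \<noteq> T2bar P D y" for x y
  proof -
    have "f x \<noteq> f y" using xy(3) classes[OF xy(1,2)] by simp
    from separation[OF xy(1,2) this] obtain g where "continuous_map ?Q euclideanreal g" "g (f x) \<noteq> g (f y)"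
      by blast
    then show ?thesis using integral by (intro exI[of _ "g \<circ> f"]) simp
  qed
  have fam: "\<exists>\<C>. (\<forall>C\<in>\<C>. continuous_first_integral P D C) \<and>
       T2bar P D z = (\<Inter>C\<in>\<C>. C -` {C z}) \<inter> points P" if z: "z \<in> points P" for z
  proof (intro exI conjI)
    \<comment> \<open>All pullbacks from \<open>?Q\<close> are taken, so a single family serves
      every \<open>z\<close>.\<close>
    let ?\<C> = "(\<lambda>g. g \<circ> f) ` {g. continuous_map ?Q euclideanreal g}"
    show "\<forall>C\<in>?\<C>. continuous_first_integral P D C" using integral by blast
    show "T2bar P D z = (\<Inter>C\<in>?\<C>. C -` {C z}) \<inter> points P"
    proof (intro equalityI subsetI)
      fix y assume y: "y \<in> T2bar P D z"
      then have yP: "y \<in> points P" by (simp add: T2bar)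
      then show "y \<in> (\<Inter>C\<in>?\<C>. C -` {C z}) \<inter> points P" using y mem[OF yP z] by auto
    next
      fix y assume y: "y \<in> (\<Inter>C\<in>?\<C>. C -` {C z}) \<inter> points P"
      then have yP: "y \<in> points P" by blast
      have "g (f y) = g (f z)" if "continuous_map ?Q euclideanreal g" for g using y that by auto
      then have "f y = f z" using separation[OF yP z] by blast
      then show "y \<in> T2bar P D z" using mem[OF yP z] by simp
    qed
  qed
  show ?thesis
    by (intro conjI ballI impI) (rule op, erule (2) sep, erule fam)
qed

end
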